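(* Let $n\ge 1$, let $g$ be an $n$-dimensional standard Gaussian vector, and let $F:\mathbb{R}^n\to\mathbb{R}$ be a convex function with $\mathbb{E}|F(g)|^2<\infty$. Let $M$ be the median of $F(g)$. Then for any $t>0$, $$\mathbb{P}\bigl(F(g)-\mathbb{E}F(g)\le -t\sqrt{\mathrm{Var}(F(g))}\bigr)\le e^{-\frac{t^2}{2}}$$ and $$\mathbb{P}\bigl(F(g)-M\le -t\sqrt{\mathrm{Var}(F(g))}\bigr)\le e^{-\frac{t^2}{2}}.$$
   Context: A standard Gaussian vector in $\mathbb{R}^n$ has i.i.d. $N(0,1)$ coordinates. A median of a real random variable $Y$ is a number $M$ with $\mathbb{P}(Y\le M)\ge 1/2$ and $\mathbb{P}(Y\ge M)\ge 1/2$. $\mathrm{Var}$ denotes variance.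
   Formalization: The convex function F is additionally assumed not to be constant; for constant F the variance is 0 and both events have probability 1, so the stated bounds fail for every t > 0. *)

theory Defs
  imports "HOL-Probability.Probability"
begin

text \<open>Independence of the coordinates includes their measurability, hence that of \<open>g\<close>.\<close>

definition std_gaussian_vector :: "'w measure \<Rightarrow> ('w \<Rightarrow> real ^ 'n) \<Rightarrow> bool" where
  "std_gaussian_vector P g \<longleftrightarrow>
     prob_space.indep_vars P (\<lambda>_. borel) (\<lambda>i \<omega>. g \<omega> $ i) UNIV \<and>
     (\<forall>i. distributed P lborel (\<lambda>\<omega>. g \<omega> $ i) std_normal_density)"

definition is_median :: "'w measure \<Rightarrow> ('w \<Rightarrow> real) \<Rightarrow> real \<Rightarrow> bool" where
  "is_median P Y m \<longleftrightarrow>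
     measure P {\<omega> \<in> space P. Y \<omega> \<le> m} \<ge> 1 / 2 \<and>
     measure P {\<omega> \<in> space P. Y \<omega> \<ge> m} \<ge> 1 / 2"

end

(* By Ehrhard's inequality the law of F(g) is that of k(xi) for a convex nondecreasing k and a
   single standard Gaussian xi, which reduces everything to dimension one. There the median k(0)
   is at most the mean by Jensen, so the second bound follows from the first. For the first,
   truncate k from below at the level c = E k - t sigma, attained at -s say: truncation does not
   increase the variance, and among convex functions vanishing up to -s the ramp (x + s)^+
   minimises the ratio of variance to squared mean, which leaves an inequality for the Gaussian
   distribution function in the single variable s.

   Ehrhard's inequality itself is proved in functional form. On the line, the probits of the heat
   flows of three functions satisfy a parabolic equation to which a two-point maximum principle
   applies (Borell's argument); the functional form then tensorises. *)
theory Submission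
  imports Defs
begin

subsection \<open>The Gaussian distribution function and its inverse\<close>

text \<open>The concave object behind the reduction is the \<open>probit\<close> of the distribution
  function of F(g): for convex F, interpolating two sublevel sets lands in the sublevel set of the
  interpolated level, so Ehrhard's inequality makes it concave, and its generalised inverse is the
  convex k. Functions replace sets because they let the induction on the dimension close:
  integrating out one coordinate and applying \<open>probit\<close> turns an admissible triple of
  functions into an admissible triple in one variable fewer. The maximum principle dictates the form
  of the data. It needs smooth solutions with bounded derivatives on a non-compact domain, so the
  data are bounded by a constant L, which keeps heat averages away from 0 and 1 where
  \<open>probit\<close> degenerates, and they are mollified; indicators of sublevel sets return only
  in a limit. In dimension one the final inequality in s is exactly the tail bound for the ramp at
  level 0. Divided by the variance, both of its sides tend to 0 as s tends to -\<infinity>, so it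
  suffices to compare derivatives.\<close>

abbreviation std_gauss :: "real measure" where
  "std_gauss \<equiv> std_normal_distribution"

abbreviation \<phi> :: "real \<Rightarrow> real" where
  "\<phi> \<equiv> std_normal_density"

definition \<Phi> :: "real \<Rightarrow> real" where
  "\<Phi> = cdf std_gauss"

definition probit :: "real \<Rightarrow> real" where
  "probit = inv \<Phi>"

interpretation gauss: real_distribution std_gauss
  by (rule real_dist_normal_dist)

lemma phi_pos [simp]: "\<phi> x > 0"
  by (simp add: normal_density_pos)

lemma phi_nonzero [simp]: "\<phi> x \<noteq> 0"
  using phi_pos[of x] by linarith

lemma phi_minus [simp]: "\<phi> (- x) = \<phi> x"
  by (simp add: std_normal_density_def)

lemma phi_bound: "\<phi> x \<le> 1"
proof -
  have "1 \<le> sqrt (2 * pi)" using pi_gt3 by (simp add: real_le_rsqrt)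
  moreover have "exp (- x\<^sup>2 / 2) \<le> 1" by simp
  ultimately have "exp (- x\<^sup>2 / 2) / sqrt (2 * pi) \<le> 1 / 1"
    by (intro frac_le) auto
  then show ?thesis
    by (simp add: std_normal_density_def)
qed

lemma DERIV_phi: "(\<phi> has_real_derivative - x * \<phi> x) (at x)"
proof -
  have "\<phi> = (\<lambda>x. (1 / sqrt (2 * pi)) * exp (- x\<^sup>2 / 2))"
    by (simp add: std_normal_density_def fun_eq_iff)
  then show ?thesis
    using phi_pos by (auto intro!: derivative_eq_intros simp: std_normal_density_def field_simps)
qed

lemmas DERIV_phi' [derivative_intros] = DERIV_chain2[OF DERIV_phi]

lemma isCont_phi: "isCont \<phi> x"
  using DERIV_phi DERIV_isCont by blast

lemma continuous_on_phi [continuous_intros]: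
  "continuous_on S f \<Longrightarrow> continuous_on S (\<lambda>x. \<phi> (f x))"
  using continuous_on_compose2[of UNIV \<phi>] isCont_phi
  by (metis continuous_at_imp_continuous_on subset_UNIV)

lemma gauss_integral: 
  fixes f :: "real \<Rightarrow> real"
  assumes "f \<in> borel_measurable borel"
  shows "gauss.expectation f = (\<integral>x. \<phi> x * f x \<partial>lborel)"
  using assms by (subst integral_density) auto

lemma gauss_integrable: 
  fixes f :: "real \<Rightarrow> real"
  assumes "f \<in> borel_measurable borel"
  shows "integrable std_gauss f \<longleftrightarrow> integrable lborel (\<lambda>x. \<phi> x * f x)"
  using assms by (subst integrable_density) auto

lemma phi_tendsto_at_top: "(\<phi> \<longlongrightarrow> 0) at_top"
  unfolding std_normal_density_def by real_asymp

lemma phi_tendsto_at_bot: "(\<phi> \<longlongrightarrow> 0) at_bot"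
  unfolding std_normal_density_def by real_asymp

lemma Phi_diff: 
  assumes "a \<le> b" shows "\<Phi> b - \<Phi> a = integral {a..b} \<phi>"
proof (cases "a = b")
  case False
  then have "\<Phi> b - \<Phi> a = measure std_gauss {a<..b}"
    unfolding \<Phi>_def using assms by (intro gauss.cdf_diff_eq) auto
  also have "\<dots> = gauss.expectation (indicator {a<..b})"
    by simp
  also have "\<dots> = (\<integral>x. \<phi> x * indicator {a<..b} x \<partial>lborel)"
    by (rule gauss_integral) auto
  also have "\<dots> = (\<integral>x. indicator {a..b} x * \<phi> x \<partial>lborel)"
    by (rule integral_cong_AE)
       (use AE_lborel_singleton[of a] in \<open>auto simp: indicator_def eventually_mono\<close>)
  also have "\<dots> = (LINT x:{a..b}|lborel. \<phi> x)"
    by (simp add: set_lebesgue_integral_def)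
  also have "\<dots> = integral {a..b} \<phi>"
    by (intro set_borel_integral_eq_integral borel_integrable_atLeastAtMost'
        continuous_intros)
  finally show ?thesis .
qed auto

lemma DERIV_Phi: "(\<Phi> has_real_derivative \<phi> x) (at x)"
proof -
  have "((\<lambda>u. integral {x-1..u} \<phi>) has_real_derivative \<phi> x) (at x within {x-1..x+1})"
    by (rule integral_has_real_derivative) (auto intro!: continuous_intros)
  then have "((\<lambda>u. \<Phi> (x-1) + integral {x-1..u} \<phi>) has_real_derivative \<phi> x) (at x within {x-1..x+1})"
    by (auto intro!: derivative_eq_intros)
  then have "(\<Phi> has_real_derivative \<phi> x) (at x within {x-1..x+1})"
    by (rule has_field_derivative_transform_within[where d=1])
       (auto simp: Phi_diff[symmetric])
  then show ?thesis
    by (simp add: at_within_Icc_at)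
qed

lemmas DERIV_Phi' [derivative_intros] = DERIV_chain2[OF DERIV_Phi]

lemma isCont_Phi: "isCont \<Phi> x"
  using DERIV_Phi DERIV_isCont by blast

lemma continuous_on_Phi [continuous_intros]:
  "continuous_on S f \<Longrightarrow> continuous_on S (\<lambda>x. \<Phi> (f x))"
  using continuous_on_compose2[of UNIV \<Phi>] isCont_Phi
  by (metis continuous_at_imp_continuous_on subset_UNIV)

lemma Phi_strict_mono: "strict_mono \<Phi>"
  unfolding strict_mono_def
  using DERIV_Phi phi_pos by (meson DERIV_pos_imp_increasing)

lemma Phi_less_iff [simp]: "\<Phi> x < \<Phi> y \<longleftrightarrow> x < y"
  using Phi_strict_mono by (simp add: strict_mono_less)

lemma Phi_le_iff [simp]: "\<Phi> x \<le> \<Phi> y \<longleftrightarrow> x \<le> y"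
  using Phi_strict_mono by (simp add: strict_mono_less_eq)

lemma Phi_tendsto_at_top: "(\<Phi> \<longlongrightarrow> 1) at_top"
  unfolding \<Phi>_def by (rule gauss.cdf_lim_at_top_prob)

lemma Phi_tendsto_at_bot: "(\<Phi> \<longlongrightarrow> 0) at_bot"
  unfolding \<Phi>_def by (rule gauss.cdf_lim_at_bot)

lemma Phi_pos [simp]: "0 < \<Phi> x"
proof -
  have "0 \<le> \<Phi> (x - 1)" by (simp add: \<Phi>_def gauss.cdf_nonneg)
  also have "\<dots> < \<Phi> x" by simp
  finally show ?thesis .
qed

lemma Phi_less_1 [simp]: "\<Phi> x < 1"
proof -
  have "\<Phi> x < \<Phi> (x + 1)" by simp
  also have "\<dots> \<le> 1" by (simp add: \<Phi>_def gauss.cdf_bounded_prob)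
  finally show ?thesis .
qed

lemma Phi_nonneg [simp]: "0 \<le> \<Phi> x" and Phi_le_1 [simp]: "\<Phi> x \<le> 1"
  and Phi_nonzero [simp]: "\<Phi> x \<noteq> 0"
  using Phi_pos[of x] Phi_less_1[of x] by linarith+

lemma Phi_minus: "\<Phi> (- x) = 1 - \<Phi> x"
proof -
  let ?g = "\<lambda>x. \<Phi> x + \<Phi> (- x)"
  have "\<forall>x. (?g has_real_derivative 0) (at x)"
    by (auto intro!: derivative_eq_intros)
  then have c: "?g y = ?g x" for y
    by (rule DERIV_isconst_all)
  have "filterlim uminus at_bot (at_top :: real filter)" 
    by (rule filterlim_uminus_at_bot_at_top)
  then have "((\<lambda>x. \<Phi> (- x)) \<longlongrightarrow> 0) at_top"
    by (rule filterlim_compose[OF Phi_tendsto_at_bot])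
  then have "(?g \<longlongrightarrow> 1 + 0) at_top"
    by (intro tendsto_intros Phi_tendsto_at_top)
  moreover have "?g = (\<lambda>y. ?g x)" using c by blast
  ultimately have "((\<lambda>y. ?g x) \<longlongrightarrow> 1) (at_top :: real filter)"
    by (metis add_0_right)
  then have "?g x = 1"
    by (simp add: tendsto_const_iff)
  then show ?thesis by simp
qed

lemma probit_Phi [simp]: "probit (\<Phi> x) = x"
  unfolding probit_def by (rule inv_f_f) (rule strict_mono_imp_inj_on[OF Phi_strict_mono])

lemma Phi_probit:
  assumes "0 < q" "q < 1" shows "\<Phi> (probit q) = q"
proof -
  obtain b where b: "q < \<Phi> b"
    using order_tendstoD(1)[OF Phi_tendsto_at_top assms(2)]
    by (auto dest!: eventually_happens'[OF trivial_limit_at_top_linorder])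
  obtain a where a: "\<Phi> a < q"
    using order_tendstoD(2)[OF Phi_tendsto_at_bot assms(1)]
    by (auto dest!: eventually_happens'[OF trivial_limit_at_bot_linorder])
  have "a \<le> b" using a b by (meson Phi_le_iff less_imp_le order_trans)
  then obtain x where "\<Phi> x = q"
    using IVT[of \<Phi> a q b] a b isCont_Phi by (auto simp: less_imp_le)
  then show ?thesis by auto
qed

lemma probit_le_iff:
  assumes "0 < p" "p < 1" "0 < q" "q < 1"
  shows "probit p \<le> probit q \<longleftrightarrow> p \<le> q"
  by (metis Phi_le_iff Phi_probit assms)

lemma isCont_probit:
  assumes "0 < q" "q < 1" shows "isCont probit q"
proof -
  have "isCont probit (\<Phi> (probit q))"
    by (rule isCont_inverse_function2[where a="probit q - 1" and b="probit q + 1"])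
       (auto simp: isCont_Phi)
  then show ?thesis using assms by (simp add: Phi_probit)
qed

lemma DERIV_probit:
  assumes "0 < q" "q < 1"
  shows "(probit has_real_derivative inverse (\<phi> (probit q))) (at q)"
  by (rule DERIV_inverse_function[where a=0 and b=1 and f=\<Phi>])
     (use assms in \<open>auto simp: DERIV_Phi Phi_probit isCont_probit\<close>)

lemma tendsto_probit:
  assumes "(f \<longlongrightarrow> q) F" "0 < q" "q < 1"
  shows "((\<lambda>x. probit (f x)) \<longlongrightarrow> probit q) F"
  using isCont_tendsto_compose[OF isCont_probit assms(1)] assms by simp

section \<open>Gaussian integration by parts\<close>

lemma gauss_integrable_bounded:
  fixes f :: "real \<Rightarrow> real"
  assumes "f \<in> borel_measurable borel" "\<And>x. \<bar>f x\<bar> \<le> B"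
  shows "integrable std_gauss f"
  by (rule gauss.integrable_const_bound[where B=B]) (use assms in auto)

text \<open>The lower end is an extended real so that one statement serves both the whole line
  (integration by parts) and a half-line (moments of the ramp).\<close>

lemma gauss_FTC:
  fixes f F :: "real \<Rightarrow> real" and a :: ereal
  assumes "a < \<infinity>"
    and F: "\<And>x. (F has_real_derivative \<phi> x * f x) (at x)"
    and f: "continuous_on UNIV f" "integrable std_gauss f"
    and A: "((F \<circ> real_of_ereal) \<longlongrightarrow> A) (at_right a)"
    and B: "(F \<longlongrightarrow> B) at_top"
  shows "gauss.expectation (\<lambda>x. indicator (einterval a \<infinity>) x * f x) = B - A"
proof -
  have fm: "f \<in> borel_measurable borel"
    using f(1) by (rule borel_measurable_continuous_onI)
  have "(LBINT x=a..\<infinity>. \<phi> x * f x) = B - A"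
  proof (rule interval_integral_FTC_integrable[where F=F])
    show "(F has_vector_derivative \<phi> x * f x) (at x)" for x
      using F by (simp add: has_real_derivative_iff_has_vector_derivative)
    show "isCont (\<lambda>x. \<phi> x * f x) x" for x
      using f(1) isCont_phi by (auto simp: continuous_on_eq_continuous_at)
    have "integrable lborel (\<lambda>x. \<phi> x * f x)"
      using f(2) fm by (simp add: gauss_integrable)
    then show "set_integrable lborel (einterval a \<infinity>) (\<lambda>x. \<phi> x * f x)"
      unfolding set_integrable_def by (intro integrable_mult_indicator) auto
    show "((F \<circ> real_of_ereal) \<longlongrightarrow> B) (at_left \<infinity>)"
      using B by (simp add: ereal_tendsto_simps)
  qed (use assms in auto)
  moreover have "(LBINT x=a..\<infinity>. \<phi> x * f x) = (\<integral>x. \<phi> x * (indicator (einterval a \<infinity>) x * f x) \<partial>lborel)"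
    using assms(1) by (simp add: interval_lebesgue_integral_def set_lebesgue_integral_def mult_ac)
  moreover have "\<dots> = gauss.expectation (\<lambda>x. indicator (einterval a \<infinity>) x * f x)"
    by (rule gauss_integral[symmetric]) (use fm in measurable)
  ultimately show ?thesis by simp
qed

text \<open>Integration by parts: \<open>\<phi> x * \<psi> x\<close> has derivative
  \<open>\<phi> x * (\<psi>' x - x * \<psi> x)\<close> and vanishes at both ends. It later trades
  the factor z, produced by differentiating f (x + a z) in a, for one more space derivative.\<close>

lemma stein:
  fixes \<psi> \<psi>' :: "real \<Rightarrow> real"
  assumes d: "\<And>x. (\<psi> has_real_derivative \<psi>' x) (at x)"
    and c: "continuous_on UNIV \<psi>'"
    and b: "\<And>x. \<bar>\<psi> x\<bar> \<le> B" and b': "\<And>x. \<bar>\<psi>' x\<bar> \<le> B'"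
  shows "gauss.expectation (\<lambda>x. x * \<psi> x) = gauss.expectation \<psi>'"
proof -
  have cp: "continuous_on UNIV \<psi>"
    using d DERIV_isCont by (auto intro!: continuous_at_imp_continuous_on)
  have m: "\<psi> \<in> borel_measurable borel" "\<psi>' \<in> borel_measurable borel"
    using c cp borel_measurable_continuous_onI by auto
  have i': "integrable std_gauss \<psi>'"
    using m b' gauss_integrable_bounded by blast
  have i: "integrable std_gauss (\<lambda>x. x * \<psi> x)"
  proof (rule Bochner_Integration.integrable_bound)
    show "integrable std_gauss (\<lambda>x. B * x)"
      using integrable_std_normal_distribution_moment[of 1] by simp
    have "B \<ge> 0" using b[of 0] by linarith
    then show "AE x in std_gauss. norm (x * \<psi> x) \<le> norm (B * x)"
      using b by (auto simp: abs_mult mult.commute[of B] intro!: mult_left_mono AE_I2)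
  qed (use m in auto)
  have lim: "((\<lambda>x. \<phi> x * \<psi> x) \<longlongrightarrow> 0) F" if "(\<phi> \<longlongrightarrow> 0) F" for F
    by (rule Lim_null_comparison[OF _ tendsto_mult_right_zero[OF that, of B]])
       (auto simp: abs_mult b mult.commute intro!: mult_right_mono always_eventually)
  have "gauss.expectation (\<lambda>x. indicator (einterval (-\<infinity>) \<infinity>) x * (\<psi>' x - x * \<psi> x)) = 0 - 0"
  proof (rule gauss_FTC[where F="\<lambda>x. \<phi> x * \<psi> x"])
    show "((\<lambda>x. \<phi> x * \<psi> x) has_real_derivative \<phi> x * (\<psi>' x - x * \<psi> x)) (at x)" for x
      by (auto intro!: derivative_eq_intros d simp: algebra_simps)
  qed (use i i' lim phi_tendsto_at_bot phi_tendsto_at_top in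
       \<open>auto intro!: continuous_intros c cp simp: ereal_tendsto_simps\<close>)
  then show ?thesis using i i' by simp
qed

subsection \<open>Ehrhard's inequality on the line\<close>

lemma DERIV_second_min:
  fixes h h' :: "real \<Rightarrow> real"
  assumes h: "\<And>r. (h has_real_derivative h' r) (at r)"
    and h': "(h' has_real_derivative D) (at 0)"
    and min: "\<And>r. h 0 \<le> h r"
  shows "h' 0 = 0" "0 \<le> D"
proof -
  show 0: "h' 0 = 0"
    by (rule DERIV_local_min[OF h, of 1]) (use min in auto)
  show "0 \<le> D"
  proof (rule ccontr)
    assume "\<not> 0 \<le> D"
    then obtain d where d: "d > 0" "\<And>r. r > 0 \<Longrightarrow> r < d \<Longrightarrow> h' r < 0"
      using DERIV_neg_dec_right[OF h'] 0 by auto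
    obtain z where z: "0 < z" "z < d / 2" "h (d / 2) - h 0 = (d / 2 - 0) * h' z"
      using MVT2[of 0 "d/2" h h'] h d(1) by auto
    then have "h (d / 2) < h 0"
      using d mult_pos_neg[of "d/2" "h' z"] by simp
    with min[of "d/2"] show False by simp
  qed
qed

text \<open>Only times up to a are compared, so the minimum may sit at the final time 1, where the
  time derivative need not vanish.\<close>

lemma DERIV_left_min:
  fixes h :: "real \<Rightarrow> real"
  assumes "(h has_real_derivative D) (at a)" "0 < a"
    and min: "\<And>b. 0 \<le> b \<Longrightarrow> b \<le> a \<Longrightarrow> h a \<le> h b"
  shows "D \<le> 0"
proof (rule ccontr)
  assume "\<not> D \<le> 0"
  then obtain d where d: "d > 0" "\<And>r. r > 0 \<Longrightarrow> r < d \<Longrightarrow> h (a - r) < h a"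
    using DERIV_pos_inc_left[OF assms(1)] by auto
  define r where "r = min (d / 2) a"
  have "r > 0" "r < d" "r \<le> a" using d(1) assms(2) by (auto simp: r_def min_def)
  with d(2)[of r] min[of "a - r"] show False by simp
qed

text \<open>If \<open>w\<close> solves \<open>w\<^sub>a = a w\<^sub>x\<^sub>x\<close>, the heat equation with time \<open>a\<^sup>2 / 2\<close>,
  then \<open>U = probit w\<close> solves the equation below.\<close>

definition ehrhard_flow :: "real \<Rightarrow> real \<Rightarrow> (real \<Rightarrow> real \<Rightarrow> real) \<Rightarrow> bool" where
  "ehrhard_flow L K U \<longleftrightarrow> continuous_on UNIV (\<lambda>(a, x). U a x) \<and> (\<forall>a x. \<bar>U a x\<bar> \<le> L) \<and>
     (\<exists>p q. (\<forall>a x. \<bar>p a x\<bar> \<le> K) \<and>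
        (\<forall>a x. (U a has_real_derivative p a x) (at x)) \<and>
        (\<forall>a x. (p a has_real_derivative q a x) (at x)) \<and>
        (\<forall>a x. ((\<lambda>a. U a x) has_real_derivative a * (q a x - U a x * (p a x)\<^sup>2)) (at a)))"

text \<open>At a minimum of the two-point function C the three slopes coincide and the second
  derivatives have a favourable sign, so the equation gives C_a \<ge> - a C p^2 with p the common
  slope; a negative minimum cannot then be decreasing in time. Since C lives on an unbounded domain
  and the sign is not strict, a quadratic penalty and a linear drift in a are added.\<close>

lemma ehrhard_flow_comparison:
  fixes U0 U1 Um :: "real \<Rightarrow> real \<Rightarrow> real"
  assumes fl: "ehrhard_flow L K U0" "ehrhard_flow L K U1" "ehrhard_flow L K Um"
    and l: "0 < l" "l < 1"
    and init: "\<And>s t. (1 - l) * U0 0 s + l * U1 0 t \<le> Um 0 ((1 - l) * s + l * t)"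
    and a0: "0 \<le> a0" "a0 \<le> 1"
  shows "(1 - l) * U0 a0 s0 + l * U1 a0 t0 \<le> Um a0 ((1 - l) * s0 + l * t0)"
proof (rule ccontr)
  assume neg: "\<not> ?thesis"
  define C where "C = (\<lambda>a s t. Um a ((1 - l) * s + l * t) - (1 - l) * U0 a s - l * U1 a t)"
  define c where "c = - C a0 s0 t0"
  have c: "c > 0" using neg by (simp add: c_def C_def)
  have bd: "\<bar>U0 a x\<bar> \<le> L" "\<bar>U1 a x\<bar> \<le> L" "\<bar>Um a x\<bar> \<le> L" for a x
    using fl by (auto simp: ehrhard_flow_def)
  have cont: "continuous_on UNIV (\<lambda>(a, x). U0 a x)" "continuous_on UNIV (\<lambda>(a, x). U1 a x)"
     "continuous_on UNIV (\<lambda>(a, x). Um a x)"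
    using fl by (auto simp: ehrhard_flow_def)
  have L: "L \<ge> 0" using bd(1)[of 0 0] by linarith
  from fl(1) obtain p0 q0 where 0: "\<And>a x. \<bar>p0 a x\<bar> \<le> K"
    "\<And>a x. (U0 a has_real_derivative p0 a x) (at x)"
    "\<And>a x. (p0 a has_real_derivative q0 a x) (at x)"
    "\<And>a x. ((\<lambda>a. U0 a x) has_real_derivative a * (q0 a x - U0 a x * (p0 a x)\<^sup>2)) (at a)"
    unfolding ehrhard_flow_def by blast
  from fl(2) obtain p1 q1 where 1: "\<And>a x. \<bar>p1 a x\<bar> \<le> K"
    "\<And>a x. (U1 a has_real_derivative p1 a x) (at x)"
    "\<And>a x. (p1 a has_real_derivative q1 a x) (at x)"
    "\<And>a x. ((\<lambda>a. U1 a x) has_real_derivative a * (q1 a x - U1 a x * (p1 a x)\<^sup>2)) (at a)"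
    unfolding ehrhard_flow_def by blast
  from fl(3) obtain pm qm where m: "\<And>a x. \<bar>pm a x\<bar> \<le> K"
    "\<And>a x. (Um a has_real_derivative pm a x) (at x)"
    "\<And>a x. (pm a has_real_derivative qm a x) (at x)"
    "\<And>a x. ((\<lambda>a. Um a x) has_real_derivative a * (qm a x - Um a x * (pm a x)\<^sup>2)) (at a)"
    unfolding ehrhard_flow_def by blast
  note D = 0(2,3) 1(2,3) m(2,3)
  note D' = D[THEN DERIV_chain2]
  have K: "K \<ge> 0" using 0(1)[of 0 0] by linarith

  \<comment> \<open>Twice the slope bound K and the bound L give the factor \<open>2 * K * L\<close>
    for a difference of the terms u p^2; the two slope errors add up to at most
    \<open>4 * sqrt e * sqrt (2 * L)\<close>.\<close>
  define k where "k = 8 * K * L * sqrt (2 * L)"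
  have k: "k \<ge> 0" unfolding k_def using K L by simp
  have "((\<lambda>e. 4 * e + k * sqrt e) \<longlongrightarrow> 0) (at_right 0)"
    by (auto intro!: tendsto_eq_intros)
  then have "eventually (\<lambda>e. 4 * e + k * sqrt e < c / 2) (at_right 0)"
    using c by (intro order_tendstoD) auto
  moreover have "((\<lambda>e. e * (s0\<^sup>2 + t0\<^sup>2)) \<longlongrightarrow> 0) (at_right 0)"
    by (auto intro!: tendsto_eq_intros)
  then have "eventually (\<lambda>e. e * (s0\<^sup>2 + t0\<^sup>2) < c / 2) (at_right 0)"
    using c by (intro order_tendstoD) auto
  moreover have "eventually (\<lambda>e::real. e > 0) (at_right 0)"
    by (simp add: eventually_at_right_less)
  ultimately have "eventually (\<lambda>e. 4 * e + k * sqrt e < c / 2 \<and> e * (s0\<^sup>2 + t0\<^sup>2) < c / 2 \<and> e > 0) (at_right (0::real))"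
    by eventually_elim auto
  then obtain e where e: "4 * e + k * sqrt e < c / 2" "e * (s0\<^sup>2 + t0\<^sup>2) < c / 2" "e > 0"
    by (auto dest!: eventually_happens)

  \<comment> \<open>At a negative minimum of the penalised \<open>G\<close> the three space derivatives agree up to
    \<open>O(sqrt e)\<close>, so the nonlinear terms add up to \<open>C * pm\<^sup>2 \<le> 0\<close> up to a small error.\<close>
  define G where "G = (\<lambda>a s t. C a s t + e * (s\<^sup>2 + t\<^sup>2) + c / 2 * a)"
  have Cb: "- (2 * L) \<le> C a s t" for a s t
  proof -
    have "\<bar>(1 - l) * U0 a s\<bar> \<le> (1 - l) * L" "\<bar>l * U1 a t\<bar> \<le> l * L"
      using bd l by (auto simp: abs_mult intro!: mult_left_mono)
    moreover have "\<bar>Um a ((1 - l) * s + l * t)\<bar> \<le> L" by (rule bd)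
    ultimately show ?thesis unfolding C_def by (simp add: algebra_simps)
  qed
  have Gneg: "G a0 s0 t0 < 0"
  proof -
    have "c / 2 * a0 \<le> c / 2 * 1" using c a0 by (intro mult_left_mono) auto
    with e(2) show ?thesis unfolding G_def using c_def by simp
  qed
  \<comment> \<open>Outside this box the penalty is at least \<open>2 * L\<close> and outweighs the
    lower bound \<open>- (2 * L)\<close> of C, so a negative minimum over the box is global. The box
    also contains (s0, t0), where G is negative.\<close>
  define R where "R = max (sqrt (2 * L / e)) (max \<bar>s0\<bar> \<bar>t0\<bar>)"
  have sq: "s\<^sup>2 \<ge> 2 * L / e" if "\<bar>s\<bar> > R" for s
  proof -
    have "sqrt (2 * L / e) \<le> \<bar>s\<bar>" using that by (simp add: R_def)
    then show ?thesis by (metis real_sqrt_le_iff real_sqrt_abs)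
  qed
  have out: "G a s t \<ge> 0" if "0 \<le> a" "\<bar>s\<bar> > R \<or> \<bar>t\<bar> > R" for a s t
  proof -
    have "s\<^sup>2 + t\<^sup>2 \<ge> 2 * L / e"
      using that(2) sq[of s] sq[of t] by (smt (verit) zero_le_power2)
    then have "e * (s\<^sup>2 + t\<^sup>2) \<ge> 2 * L" using e(3) by (simp add: field_simps)
    then show ?thesis using Cb[of a s t] that(1) c unfolding G_def by (smt (verit) mult_nonneg_nonneg divide_nonneg_nonneg)
  qed
  define S where "S = {0..1::real} \<times> {-R..R} \<times> {-R..R}"
  have "compact S" unfolding S_def by (intro compact_Times compact_Icc)
  moreover have "(a0, s0, t0) \<in> S" unfolding S_def R_def using a0 by auto
  moreover have "continuous_on S (\<lambda>(a, s, t). G a s t)"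
  proof -
    have "continuous_on UNIV (\<lambda>z. Um (fst z) ((1 - l) * fst (snd z) + l * snd (snd z)))"
      by (rule continuous_on_compose2[OF cont(3), where f="\<lambda>z. (fst z, (1 - l) * fst (snd z) + l * snd (snd z))", simplified])
         (intro continuous_intros)
    moreover have "continuous_on UNIV (\<lambda>z::real\<times>real\<times>real. U0 (fst z) (fst (snd z)))"
      by (rule continuous_on_compose2[OF cont(1), where f="\<lambda>z. (fst z, fst (snd z))", simplified])
         (intro continuous_intros)
    moreover have "continuous_on UNIV (\<lambda>z::real\<times>real\<times>real. U1 (fst z) (snd (snd z)))"
      by (rule continuous_on_compose2[OF cont(2), where f="\<lambda>z. (fst z, snd (snd z))", simplified])
         (intro continuous_intros)
    ultimately have "continuous_on UNIV (\<lambda>z. G (fst z) (fst (snd z)) (snd (snd z)))"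
      unfolding G_def C_def by (intro continuous_intros)
    then show ?thesis by (auto simp: case_prod_beta' intro: continuous_on_subset)
  qed
  ultimately obtain z where "z \<in> S" and zmin: "\<And>y. y \<in> S \<Longrightarrow> (\<lambda>(a, s, t). G a s t) z \<le> (\<lambda>(a, s, t). G a s t) y"
    using continuous_attains_inf[of S "\<lambda>(a, s, t). G a s t"] by (metis empty_iff)
  obtain a s t where z: "z = (a, s, t)" by (cases z)
  have a: "0 \<le> a" "a \<le> 1" using \<open>z \<in> S\<close> by (auto simp: z S_def)
  have Gast: "G a s t < 0"
    using zmin[of "(a0, s0, t0)"] Gneg \<open>(a0, s0, t0) \<in> S\<close> by (simp add: z)
  have min: "G a s t \<le> G a' s' t'" if "0 \<le> a'" "a' \<le> 1" for a' s' t'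
  proof (cases "(a', s', t') \<in> S")
    case True
    then show ?thesis using zmin[of "(a', s', t')"] by (simp add: z)
  next
    case False
    then have "\<bar>s'\<bar> > R \<or> \<bar>t'\<bar> > R" using that by (auto simp: S_def abs_le_iff not_le)
    then show ?thesis using out[of a' s' t'] that Gast by simp
  qed
  have G0: "G 0 s t \<ge> 0" unfolding G_def C_def using init[of s t] e by simp
  have "a > 0" using a Gast G0 by (cases "a = 0") auto
  define x where "x = (1 - l) * s + l * t"

  have ds: "(1 - l) * (pm a x - p0 a s) + 2 * e * s = 0"
  proof (rule DERIV_local_min[where d=1 and f="\<lambda>s. G a s t"])
    show "((\<lambda>s. G a s t) has_real_derivative (1 - l) * (pm a x - p0 a s) + 2 * e * s) (at s)"
      unfolding G_def C_def x_def
      by (auto intro!: derivative_eq_intros D' simp: algebra_simps)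
  qed (use min a in auto)
  have dt: "l * (pm a x - p1 a t) + 2 * e * t = 0"
  proof (rule DERIV_local_min[where d=1 and f="\<lambda>t. G a s t"])
    show "((\<lambda>t. G a s t) has_real_derivative l * (pm a x - p1 a t) + 2 * e * t) (at t)"
      unfolding G_def C_def x_def
      by (auto intro!: derivative_eq_intros D' simp: algebra_simps)
  qed (use min a in auto)
  \<comment> \<open>Along the diagonal direction (1, 1) the combined point moves with speed (1 - l)
    + l = 1, so \<open>qm\<close>, \<open>q0\<close> and \<open>q1\<close> appear with the same
    weights as in the equation.\<close>
  have dd: "0 \<le> qm a x - (1 - l) * q0 a s - l * q1 a t + 4 * e"
  proof (rule DERIV_second_min(2)[where h="\<lambda>r. G a (s + r) (t + r)" and
     h'="\<lambda>r. pm a ((1 - l) * (s + r) + l * (t + r)) - (1 - l) * p0 a (s + r) - l * p1 a (t + r)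
           + 2 * e * (s + r) + 2 * e * (t + r)"])
    show "((\<lambda>r. G a (s + r) (t + r)) has_real_derivative 
        pm a ((1 - l) * (s + r) + l * (t + r)) - (1 - l) * p0 a (s + r) - l * p1 a (t + r)
           + 2 * e * (s + r) + 2 * e * (t + r)) (at r)" for r
      unfolding G_def C_def 
      by (auto intro!: derivative_eq_intros D' simp: algebra_simps)
    show "((\<lambda>r. pm a ((1 - l) * (s + r) + l * (t + r)) - (1 - l) * p0 a (s + r) - l * p1 a (t + r)
           + 2 * e * (s + r) + 2 * e * (t + r)) has_real_derivative
           qm a x - (1 - l) * q0 a s - l * q1 a t + 4 * e) (at 0)"
      unfolding x_def
      by (auto intro!: derivative_eq_intros D' simp: algebra_simps)
  qed (use min a in simp)
  define T where "T = a * (qm a x - Um a x * (pm a x)\<^sup>2)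
     - (1 - l) * (a * (q0 a s - U0 a s * (p0 a s)\<^sup>2)) - l * (a * (q1 a t - U1 a t * (p1 a t)\<^sup>2))"
  have da: "T + c / 2 \<le> 0"
  proof (rule DERIV_left_min[where h="\<lambda>a. G a s t" and a=a])
    show "((\<lambda>a. G a s t) has_real_derivative T + c / 2) (at a)"
      unfolding G_def C_def T_def x_def
      by (auto intro!: derivative_eq_intros 0(4) 1(4) m(4))
  qed (use min a \<open>a > 0\<close> in auto)

  have Cneg: "C a s t \<le> 0" and es: "e * (s\<^sup>2 + t\<^sup>2) \<le> 2 * L"
  proof -
    have "0 \<le> e * (s\<^sup>2 + t\<^sup>2)" "0 \<le> c / 2 * a" using e c a by auto
    then show "C a s t \<le> 0" "e * (s\<^sup>2 + t\<^sup>2) \<le> 2 * L"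
      using Gast Cb[of a s t] unfolding G_def by linarith+
  qed
  have small: "e * \<bar>r\<bar> \<le> sqrt e * sqrt (2 * L)" if "e * r\<^sup>2 \<le> 2 * L" for r
  proof -
    have "e * \<bar>r\<bar> = sqrt e * sqrt (e * r\<^sup>2)" using e(3) by (simp add: real_sqrt_mult)
    also have "\<dots> \<le> sqrt e * sqrt (2 * L)" using that e(3) by (intro mult_left_mono) auto
    finally show ?thesis .
  qed
  have sb: "e * \<bar>s\<bar> \<le> sqrt e * sqrt (2 * L)" "e * \<bar>t\<bar> \<le> sqrt e * sqrt (2 * L)"
  proof -
    have "e * s\<^sup>2 \<le> e * (s\<^sup>2 + t\<^sup>2)" "e * t\<^sup>2 \<le> e * (s\<^sup>2 + t\<^sup>2)"
      using e(3) by (auto intro!: mult_left_mono)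
    then show "e * \<bar>s\<bar> \<le> sqrt e * sqrt (2 * L)" "e * \<bar>t\<bar> \<le> sqrt e * sqrt (2 * L)"
      using es by (auto intro!: small)
  qed
  have sqb: "\<bar>u * (p\<^sup>2 - p'\<^sup>2)\<bar> \<le> 2 * K * L * \<bar>p - p'\<bar>"
    if "\<bar>u\<bar> \<le> L" "\<bar>p\<bar> \<le> K" "\<bar>p'\<bar> \<le> K" for u p p'
  proof -
    have "\<bar>u * (p\<^sup>2 - p'\<^sup>2)\<bar> = \<bar>u\<bar> * \<bar>p + p'\<bar> * \<bar>p - p'\<bar>"
      by (simp add: abs_mult power2_eq_square square_diff_square_factored)
    also have "\<dots> \<le> L * (2 * K) * \<bar>p - p'\<bar>"
      using that L by (intro mult_mono) auto
    finally show ?thesis by (simp add: mult_ac)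
  qed
  have d0: "(1 - l) * \<bar>pm a x - p0 a s\<bar> = 2 * (e * \<bar>s\<bar>)"
  proof -
    have "(1 - l) * (pm a x - p0 a s) = - (2 * e * s)" using ds by simp
    then have "\<bar>(1 - l) * (pm a x - p0 a s)\<bar> = \<bar>2 * e * s\<bar>" by simp
    then show ?thesis using l e(3) by (simp add: abs_mult)
  qed
  have d1: "l * \<bar>pm a x - p1 a t\<bar> = 2 * (e * \<bar>t\<bar>)"
  proof -
    have "l * (pm a x - p1 a t) = - (2 * e * t)" using dt by simp
    then have "\<bar>l * (pm a x - p1 a t)\<bar> = \<bar>2 * e * t\<bar>" by simp
    then show ?thesis using l e(3) by (simp add: abs_mult)
  qed
  \<comment> \<open>Replacing all slopes by \<open>pm a x\<close> leaves C times its square, which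
    is not positive; the two remainders are controlled by the first-order conditions.\<close>
  have "Um a x * (pm a x)\<^sup>2 - (1 - l) * (U0 a s * (p0 a s)\<^sup>2) - l * (U1 a t * (p1 a t)\<^sup>2)
     = C a s t * (pm a x)\<^sup>2 + (1 - l) * (U0 a s * ((pm a x)\<^sup>2 - (p0 a s)\<^sup>2)) 
         + l * (U1 a t * ((pm a x)\<^sup>2 - (p1 a t)\<^sup>2))"
    unfolding C_def x_def by (simp add: algebra_simps)
  also have "\<dots> \<le> 0 + (1 - l) * (2 * K * L * \<bar>pm a x - p0 a s\<bar>) + l * (2 * K * L * \<bar>pm a x - p1 a t\<bar>)"
    using Cneg l bd 0(1) 1(1) m(1)
    by (intro add_mono mult_left_mono mult_nonpos_nonneg order_trans[OF abs_ge_self sqb]) auto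
  also have "\<dots> = 2 * K * L * (2 * (e * \<bar>s\<bar>) + 2 * (e * \<bar>t\<bar>))"
    unfolding d0[symmetric] d1[symmetric] by (simp add: algebra_simps)
  also have "\<dots> \<le> 2 * K * L * (2 * (sqrt e * sqrt (2 * L)) + 2 * (sqrt e * sqrt (2 * L)))"
    using sb K L by (intro mult_left_mono add_mono) auto
  also have "\<dots> = k * sqrt e" by (simp add: k_def)
  \<comment> \<open>By the choice of e the right-hand side exceeds \<open>- (c / 2)\<close>, and a
    factor a \<le> 1 does not spoil this, whereas the minimum in time forces
    \<open>T \<le> - (c / 2)\<close>.\<close>
  finally have "(qm a x - (1 - l) * q0 a s - l * q1 a t) - (Um a x * (pm a x)\<^sup>2 - (1 - l) * (U0 a s * (p0 a s)\<^sup>2) - l * (U1 a t * (p1 a t)\<^sup>2)) \<ge> - (4 * e + k * sqrt e)"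
    using dd by linarith
  then have "a * ((qm a x - (1 - l) * q0 a s - l * q1 a t) - (Um a x * (pm a x)\<^sup>2 - (1 - l) * (U0 a s * (p0 a s)\<^sup>2) - l * (U1 a t * (p1 a t)\<^sup>2))) \<ge> a * - (4 * e + k * sqrt e)"
    using a by (intro mult_left_mono)
  moreover have "a * (4 * e + k * sqrt e) \<le> 1 * (4 * e + k * sqrt e)"
    using a e k by (intro mult_right_mono) auto
  ultimately have "T \<ge> - (4 * e + k * sqrt e)"
    unfolding T_def by (simp add: algebra_simps)
  with da e(1) show False by linarith
qed

section \<open>Heat flow and regularisation of its initial data\<close>

lemma DERIV_continuous_on_UNIV:
  fixes f :: "real \<Rightarrow> real"
  shows "(\<And>x. (f has_real_derivative f' x) (at x)) \<Longrightarrow> continuous_on UNIV f"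
  by (meson DERIV_isCont continuous_at_imp_continuous_on)

text \<open>By the mean value inequality the bound W on the derivative also dominates every
  difference quotient.\<close>

lemma DERIV_gauss_expectation:
  fixes h h' :: "real \<Rightarrow> real \<Rightarrow> real"
  assumes d: "\<And>t z. ((\<lambda>t. h t z) has_real_derivative h' t z) (at t)"
    and b: "\<And>t z. \<bar>h' t z\<bar> \<le> W z" and W: "integrable std_gauss W"
    and m: "\<And>t. h t \<in> borel_measurable borel" "\<And>t. h' t \<in> borel_measurable borel"
    and i: "\<And>t. integrable std_gauss (h t)"
  shows "((\<lambda>t. gauss.expectation (h t)) has_real_derivative gauss.expectation (h' t)) (at t)"
proof -
  have "((\<lambda>r. (gauss.expectation (h (t + r)) - gauss.expectation (h t)) / r) \<longlongrightarrow> gauss.expectation (h' t)) (at 0)"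
    unfolding tendsto_at_iff_sequentially comp_def
  proof (intro allI impI)
    fix X :: "nat \<Rightarrow> real" assume X: "\<forall>i. X i \<in> UNIV - {0}" "X \<longlonglongrightarrow> 0"
    have "(\<lambda>i. gauss.expectation (\<lambda>z. (h (t + X i) z - h t z) / X i)) \<longlonglongrightarrow> gauss.expectation (h' t)"
    proof (rule integral_dominated_convergence[where w=W])
      show "AE z in std_gauss. (\<lambda>i. (h (t + X i) z - h t z) / X i) \<longlonglongrightarrow> h' t z"
      proof (rule AE_I2)
        fix z
        have "((\<lambda>r. (h (t + r) z - h t z) / r) \<longlongrightarrow> h' t z) (at 0)"
          using d[of z t] by (simp add: DERIV_def)
        then show "(\<lambda>i. (h (t + X i) z - h t z) / X i) \<longlonglongrightarrow> h' t z"
          using X unfolding tendsto_at_iff_sequentially comp_def by blast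
      qed
      show "AE z in std_gauss. norm ((h (t + X i) z - h t z) / X i) \<le> W z" for i
      proof (rule AE_I2)
        fix z
        have "norm (h (t + X i) z - h t z) \<le> W z * norm (t + X i - t)"
          by (rule field_differentiable_bound[where S=UNIV and f'="\<lambda>t. h' t z"])
             (use d b in auto)
        then show "norm ((h (t + X i) z - h t z) / X i) \<le> W z"
          using X(1) by (auto simp: field_simps)
      qed
    qed (use m W in auto)
    then show "(\<lambda>i. (gauss.expectation (h (t + X i)) - gauss.expectation (h t)) / X i) \<longlonglongrightarrow> gauss.expectation (h' t)"
      using i by simp
  qed
  then show ?thesis by (simp add: DERIV_def)
qed

text \<open>The parameter is the standard deviation, not the variance: the formula then makes sense
  and is differentiable for every real a, including the initial time 0.\<close>

definition heat :: "(real \<Rightarrow> real) \<Rightarrow> real \<Rightarrow> real \<Rightarrow> real" where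
  "heat f a x = gauss.expectation (\<lambda>z. f (x + a * z))"

lemma heat_0 [simp]: "heat f 0 x = f x"
  using gauss.prob_space by (simp add: heat_def)

lemma borel_measurable_shift:
  fixes f :: "real \<Rightarrow> real"
  assumes "continuous_on UNIV f" 
  shows "(\<lambda>z. f (x + a * z)) \<in> borel_measurable borel"
  by (intro borel_measurable_continuous_onI continuous_on_compose2[OF assms] continuous_intros) auto

lemma heat_integrable:
  fixes f :: "real \<Rightarrow> real"
  assumes "continuous_on UNIV f" "\<And>x. \<bar>f x\<bar> \<le> B"
  shows "integrable std_gauss (\<lambda>z. f (x + a * z))"
  using borel_measurable_shift[OF assms(1)] assms(2) by (rule gauss_integrable_bounded)

lemma heat_bounds:
  assumes "continuous_on UNIV f" "\<And>x. \<bar>f x\<bar> \<le> B" "\<And>x. lo \<le> f x" "\<And>x. f x \<le> hi"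
  shows "lo \<le> heat f a x" "heat f a x \<le> hi"
  unfolding heat_def
  by (intro gauss.integral_ge_const gauss.integral_le_const heat_integrable[OF assms(1,2)] AE_I2 assms)+

lemma heat_abs_le:
  assumes "continuous_on UNIV f" "\<And>x. \<bar>f x\<bar> \<le> B"
  shows "\<bar>heat f a x\<bar> \<le> B"
  using heat_bounds[OF assms, of "-B" B a x] assms(2) by (auto simp: abs_le_iff minus_le_iff)

lemma continuous_on_heat:
  assumes f: "continuous_on UNIV f" "\<And>x. \<bar>f x\<bar> \<le> B"
  shows "continuous_on UNIV (\<lambda>(a, x). heat f a x)"
proof -
  have "isCont (\<lambda>(a, x). heat f a x) y" for y
    unfolding continuous_at_sequentially comp_def
  proof (intro allI impI)
    fix u assume u: "u \<longlonglongrightarrow> y"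
    have "(\<lambda>n. gauss.expectation (\<lambda>z. f (snd (u n) + fst (u n) * z))) \<longlonglongrightarrow> gauss.expectation (\<lambda>z. f (snd y + fst y * z))"
    proof (rule integral_dominated_convergence[where w="\<lambda>_. B"])
      show "AE z in std_gauss. (\<lambda>n. f (snd (u n) + fst (u n) * z)) \<longlonglongrightarrow> f (snd y + fst y * z)"
      proof (rule AE_I2)
        fix z
        have "(\<lambda>n. snd (u n) + fst (u n) * z) \<longlonglongrightarrow> snd y + fst y * z"
          by (intro tendsto_intros u)
        then show "(\<lambda>n. f (snd (u n) + fst (u n) * z)) \<longlonglongrightarrow> f (snd y + fst y * z)"
          using f(1) continuous_on_tendsto_compose[of UNIV f] by auto
      qed
    qed (use borel_measurable_shift[OF f(1)] f(2) in auto)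
    then show "(\<lambda>n. case u n of (a, x) \<Rightarrow> heat f a x) \<longlonglongrightarrow> (case y of (a, x) \<Rightarrow> heat f a x)"
      by (simp add: heat_def case_prod_beta')
  qed
  then show ?thesis by (simp add: continuous_at_imp_continuous_on)
qed

lemma DERIV_heat_x:
  assumes d: "\<And>x. (f has_real_derivative f' x) (at x)"
    and c: "continuous_on UNIV f'" and b: "\<And>x. \<bar>f x\<bar> \<le> B" "\<And>x. \<bar>f' x\<bar> \<le> B'"
  shows "(heat f a has_real_derivative heat f' a x) (at x)"
proof -
  have cf: "continuous_on UNIV f"
    using d by (auto intro!: DERIV_continuous_on_UNIV)
  show ?thesis
    unfolding heat_def[abs_def]
  proof (rule DERIV_gauss_expectation[where W="\<lambda>_. B'"])
    show "((\<lambda>t. f (t + a * z)) has_real_derivative f' (t + a * z)) (at t)" for t z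
    proof -
      have "((\<lambda>t. t + a * z) has_real_derivative 1) (at t)" by (auto intro!: derivative_eq_intros)
      from DERIV_chain2[OF d this] show ?thesis by simp
    qed
  qed (auto intro!: borel_measurable_shift cf c b heat_integrable[OF cf b(1)])
qed

lemma DERIV_heat_a:
  assumes d: "\<And>x. (f has_real_derivative f' x) (at x)" "\<And>x. (f' has_real_derivative f'' x) (at x)"
    and c: "continuous_on UNIV f''" 
    and b: "\<And>x. \<bar>f x\<bar> \<le> B" "\<And>x. \<bar>f' x\<bar> \<le> B'" "\<And>x. \<bar>f'' x\<bar> \<le> B''"
  shows "((\<lambda>a. heat f a x) has_real_derivative a * heat f'' a x) (at a)"
proof -
  have cf: "continuous_on UNIV f" "continuous_on UNIV f'"
    using d by (auto intro!: DERIV_continuous_on_UNIV)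
  have "((\<lambda>a. heat f a x) has_real_derivative gauss.expectation (\<lambda>z. z * f' (x + a * z))) (at a)"
    unfolding heat_def
  proof (rule DERIV_gauss_expectation[where W="\<lambda>z. B' * \<bar>z\<bar>"])
    show "integrable std_gauss (\<lambda>z. B' * \<bar>z\<bar>)"
      using integrable_std_normal_distribution_moment[of 1] by simp
    show "\<bar>z * f' (x + t * z)\<bar> \<le> B' * \<bar>z\<bar>" for t z
      using b(2) by (simp add: abs_mult mult.commute[of B'] mult_left_mono)
    show "((\<lambda>a. f (x + a * z)) has_real_derivative z * f' (x + t * z)) (at t)" for t z
    proof -
      have "((\<lambda>t. x + t * z) has_real_derivative z) (at t)" by (auto intro!: derivative_eq_intros)
      from DERIV_chain2[OF d(1) this] show ?thesis by (simp add: mult.commute)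
    qed
  qed (use borel_measurable_shift[OF cf(2)] in \<open>auto intro!: borel_measurable_shift[OF cf(1)] heat_integrable[OF cf(1) b(1)]\<close>)
  \<comment> \<open>Integration by parts removes z and yields the heat equation w_a = a
    w_xx.\<close>
  also have "gauss.expectation (\<lambda>z. z * f' (x + a * z)) = gauss.expectation (\<lambda>z. a * f'' (x + a * z))"
  proof (rule stein[where B=B' and B'="\<bar>a\<bar> * B''"])
    show "continuous_on UNIV (\<lambda>z. a * f'' (x + a * z))"
      by (intro continuous_intros continuous_on_compose2[OF c]) auto
    show "\<bar>a * f'' (x + a * z)\<bar> \<le> \<bar>a\<bar> * B''" for z
      using b(3) by (simp add: abs_mult mult_left_mono)
    show "((\<lambda>z. f' (x + a * z)) has_real_derivative a * f'' (x + a * z)) (at z)" for z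
    proof -
      have "((\<lambda>z. x + a * z) has_real_derivative a) (at z)" by (auto intro!: derivative_eq_intros)
      from DERIV_chain2[OF d(2) this] show ?thesis by (simp add: mult.commute)
    qed
  qed (rule b)
  also have "\<dots> = a * heat f'' a x" by (simp add: heat_def)
  finally show ?thesis .
qed

lemma probit_bounds:
  assumes "\<Phi> lo \<le> q" "q \<le> \<Phi> hi"
  shows "0 < q" "q < 1" "lo \<le> probit q" "probit q \<le> hi"
proof -
  show q: "0 < q" "q < 1"
    using assms Phi_pos[of lo] Phi_less_1[of hi] by linarith+
  show "lo \<le> probit q" "probit q \<le> hi"
    using assms Phi_probit[OF q] by (metis Phi_le_iff)+
qed

definition flow :: "(real \<Rightarrow> real) \<Rightarrow> real \<Rightarrow> real \<Rightarrow> real" where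
  "flow u a x = probit (heat (\<lambda>y. \<Phi> (u y)) a x)"

lemma flow_0 [simp]: "flow u 0 x = u x"
  by (simp add: flow_def)

lemma phi_antimono_abs: "\<bar>x\<bar> \<le> y \<Longrightarrow> \<phi> y \<le> \<phi> x"
  unfolding std_normal_density_def
  by (auto intro!: divide_right_mono simp: abs_le_square_iff[symmetric])

text \<open>Let w be the heat flow of \<open>\<Phi> (u y)\<close> and U = \<open>probit\<close> w.
  Then U_x = w_x / \<phi>(U), and because \<phi>'(x) = - x \<phi>(x), U_xx = w_xx / \<phi>(U) + U
  U_x^2. Solving for w_xx turns the heat equation into the nonlinear one.\<close>

lemma ehrhard_flow_flow:
  assumes d: "\<And>x. (u has_real_derivative u' x) (at x)" "\<And>x. (u' has_real_derivative u'' x) (at x)"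
    and c: "continuous_on UNIV u''" 
    and b: "\<And>x. \<bar>u x\<bar> \<le> L" "\<And>x. \<bar>u' x\<bar> \<le> B" "\<And>x. \<bar>u'' x\<bar> \<le> B"
  shows "ehrhard_flow L (B / \<phi> L) (flow u)"
proof -
  define f where "f = (\<lambda>x. \<Phi> (u x))"
  define f' where "f' = (\<lambda>x. \<phi> (u x) * u' x)"
  define f'' where "f'' = (\<lambda>x. \<phi> (u x) * (u'' x - u x * (u' x)\<^sup>2))"
  have cu: "continuous_on UNIV u" "continuous_on UNIV u'"
    using d by (auto intro!: DERIV_continuous_on_UNIV)
  have df: "(f has_real_derivative f' x) (at x)" "(f' has_real_derivative f'' x) (at x)" for x
    unfolding f_def f'_def f''_def
    by (auto intro!: derivative_eq_intros d simp: algebra_simps power2_eq_square)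
  have cf: "continuous_on UNIV f" "continuous_on UNIV f'" "continuous_on UNIV f''"
    unfolding f_def f'_def f''_def by (intro continuous_intros cu c)+
  have B0: "B \<ge> 0" "L \<ge> 0" using b(1)[of 0] b(2)[of 0] by linarith+
  have bf: "\<bar>f x\<bar> \<le> 1" for x
    unfolding f_def by simp
  have bf': "\<bar>f' x\<bar> \<le> B" for x
  proof -
    have "\<bar>f' x\<bar> \<le> 1 * B"
      unfolding f'_def abs_mult by (intro mult_mono b) (auto simp: phi_bound)
    then show ?thesis by simp
  qed
  have bf'': "\<bar>f'' x\<bar> \<le> B + L * B\<^sup>2" for x
  proof -
    have "\<bar>u'' x - u x * (u' x)\<^sup>2\<bar> \<le> \<bar>u'' x\<bar> + \<bar>u x * (u' x)\<^sup>2\<bar>" by (rule abs_triangle_ineq4)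
    also have "\<bar>u x * (u' x)\<^sup>2\<bar> \<le> L * B\<^sup>2"
      unfolding abs_mult using b B0 by (intro mult_mono) (auto simp: power2_le_iff_abs_le)
    finally have "\<bar>u'' x - u x * (u' x)\<^sup>2\<bar> \<le> B + L * B\<^sup>2" using b(3)[of x] by linarith
    then have "\<bar>f'' x\<bar> \<le> 1 * (B + L * B\<^sup>2)"
      unfolding f''_def abs_mult by (intro mult_mono) (auto simp: phi_bound)
    then show ?thesis by simp
  qed
  \<comment> \<open>Averages of values in [\<Phi>(-L), \<Phi>(L)] remain there. This preserves the
    bound L, keeps \<open>probit\<close> differentiable, and bounds 1 / \<phi>(U) by 1 /
    \<phi>(L).\<close>
  have rng: "\<Phi> (- L) \<le> heat f a x" "heat f a x \<le> \<Phi> L" for a x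
  proof -
    have "- L \<le> u y" "u y \<le> L" for y using b(1)[of y] by linarith+
    then have "\<Phi> (- L) \<le> f y" "f y \<le> \<Phi> L" for y by (auto simp: f_def)
    then show "\<Phi> (- L) \<le> heat f a x" "heat f a x \<le> \<Phi> L"
      using heat_bounds[OF cf(1) bf] by blast+
  qed
  note rng' = probit_bounds[OF rng]
  have fl: "flow u = (\<lambda>a x. probit (heat f a x))"
    by (simp add: flow_def[abs_def] f_def)
  have bfl: "\<bar>flow u a x\<bar> \<le> L" for a x
    using rng'(3,4)[of a x] by (auto simp: fl abs_le_iff)
  define p where "p = (\<lambda>a x. heat f' a x / \<phi> (flow u a x))"
  define q where "q = (\<lambda>a x. heat f'' a x / \<phi> (flow u a x) + flow u a x * (p a x)\<^sup>2)"
  have dx: "(flow u a has_real_derivative p a x) (at x)" for a x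
    unfolding fl p_def
    by (rule DERIV_cong[OF DERIV_chain2[OF DERIV_probit[OF rng'(1,2)] DERIV_heat_x[OF df(1) cf(2) bf bf']]])
       (simp add: field_simps)
  have dp: "(p a has_real_derivative q a x) (at x)" for a x
    unfolding p_def q_def
    by (auto intro!: derivative_eq_intros dx DERIV_heat_x[OF df(2) cf(3) bf' bf''] 
        simp: p_def field_simps power2_eq_square)
  have da: "((\<lambda>a. flow u a x) has_real_derivative a * (q a x - flow u a x * (p a x)\<^sup>2)) (at a)" for a x
    unfolding fl 
    by (rule DERIV_cong[OF DERIV_chain2[OF DERIV_probit[OF rng'(1,2)] DERIV_heat_a[OF df cf(3) bf bf' bf'']]])
       (simp add: field_simps q_def fl)
  have "continuous_on UNIV (\<lambda>(a, x). flow u a x)"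
  proof -
    have "continuous_on UNIV (\<lambda>y. probit (heat f (fst y) (snd y)))"
    proof (rule continuous_on_compose2[of "{0<..<1}" probit])
      show "continuous_on {0<..<1} probit"
        using isCont_probit by (auto intro!: continuous_at_imp_continuous_on)
      show "continuous_on UNIV (\<lambda>y. heat f (fst y) (snd y))"
        using continuous_on_heat[OF cf(1) bf] by (simp add: case_prod_beta')
    qed (use rng' in auto)
    then show ?thesis by (simp add: fl case_prod_beta')
  qed
  moreover have "\<bar>p a x\<bar> \<le> B / \<phi> L" for a x
  proof -
    have "\<bar>heat f' a x\<bar> \<le> B" by (rule heat_abs_le[OF cf(2) bf'])
    moreover have "\<phi> L \<le> \<phi> (flow u a x)" using bfl by (rule phi_antimono_abs)
    ultimately show ?thesis
      unfolding p_def abs_divide using B0 by (intro frac_le) (auto simp: less_imp_le)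
  qed
  ultimately show ?thesis
    unfolding ehrhard_flow_def using bfl dx dp da by blast
qed

text \<open>Applied twice, this makes a continuous function \<open>C\<^sup>2\<close>.\<close>

definition moving_avg :: "real \<Rightarrow> (real \<Rightarrow> real) \<Rightarrow> real \<Rightarrow> real" where
  "moving_avg d u x = integral {0..1} (\<lambda>r. u (x + d * r))"

lemma moving_avg_integrable:
  fixes u :: "real \<Rightarrow> real"
  assumes "continuous_on UNIV u"
  shows "(\<lambda>r. u (x + d * r)) integrable_on {0..1}"
  by (intro integrable_continuous_real continuous_on_compose2[OF assms] continuous_intros) auto

lemma moving_avg_abs_le:
  assumes "continuous_on UNIV u" "\<And>x. \<bar>u x\<bar> \<le> L"
  shows "\<bar>moving_avg d u x\<bar> \<le> L"
proof -
  have "norm (moving_avg d u x) \<le> L * (1 - 0)"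
    unfolding moving_avg_def by (rule integral_bound)
     (use assms in \<open>auto intro!: continuous_on_compose2[OF assms(1)] continuous_intros\<close>)
  then show ?thesis by simp
qed

text \<open>By substitution the average is a difference quotient of an antiderivative of u.\<close>

lemma DERIV_moving_avg:
  assumes u: "continuous_on UNIV u" and d: "d \<noteq> 0"
  shows "(moving_avg d u has_real_derivative (u (x + d) - u x) / d) (at x)"
proof -
  have "\<exists>G. \<forall>x::real. (-\<infinity>::ereal) < x \<longrightarrow> x < \<infinity> \<longrightarrow> (G has_vector_derivative u x) (at x)"
    by (rule einterval_antiderivative) (use u in \<open>auto simp: continuous_on_eq_continuous_at\<close>)
  then obtain G where G: "\<And>x. (G has_real_derivative u x) (at x)"
    by (auto simp: has_real_derivative_iff_has_vector_derivative)
  have "moving_avg d u = (\<lambda>x. (G (x + d) - G x) / d)"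
  proof
    fix x
    have "((\<lambda>r. u (x + d * r)) has_integral (G (x + d * 1) / d - G (x + d * 0) / d)) {0..1}"
    proof (rule fundamental_theorem_of_calculus)
      fix r
      have "((\<lambda>r. x + d * r) has_real_derivative d) (at r within {0..1})" 
        by (auto intro!: derivative_eq_intros)
      from DERIV_chain2[OF G this] 
      have "((\<lambda>r. G (x + d * r) / d) has_real_derivative u (x + d * r)) (at r within {0..1})"
        using d by (auto intro!: derivative_eq_intros)
      then show "((\<lambda>r. G (x + d * r) / d) has_vector_derivative u (x + d * r)) (at r within {0..1})"
        by (simp add: has_real_derivative_iff_has_vector_derivative)
    qed simp
    then show "moving_avg d u x = (G (x + d) - G x) / d"
      unfolding moving_avg_def by (simp add: integral_unique diff_divide_distrib)
  qed
  moreover have "((\<lambda>x. G (x + d)) has_real_derivative u (x + d)) (at x)"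
    using G[of "x + d"] by (simp add: DERIV_shift)
  ultimately show ?thesis
    using d by (auto intro!: derivative_eq_intros G)
qed

lemma continuous_on_moving_avg:
  assumes "continuous_on UNIV u" "d \<noteq> 0"
  shows "continuous_on UNIV (moving_avg d u)"
  using DERIV_moving_avg[OF assms] by (rule DERIV_continuous_on_UNIV)

text \<open>Shifting both points by the same \<open>d * r\<close> shifts their combination by
  \<open>d * r\<close>, so the hypothesis can be averaged over r.\<close>

lemma moving_avg_convex_combination:
  assumes c: "continuous_on UNIV u0" "continuous_on UNIV u1" "continuous_on UNIV um"
    and le: "\<And>s t. (1 - l) * u0 s + l * u1 t \<le> um ((1 - l) * s + l * t)"
  shows "(1 - l) * moving_avg d u0 s + l * moving_avg d u1 t \<le> moving_avg d um ((1 - l) * s + l * t)"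
proof -
  have "(1 - l) * moving_avg d u0 s + l * moving_avg d u1 t 
    = integral {0..1} (\<lambda>r. (1 - l) * u0 (s + d * r) + l * u1 (t + d * r))"
    unfolding moving_avg_def using c
    by (simp add: Henstock_Kurzweil_Integration.integral_add moving_avg_integrable integrable_on_mult_right)
  also have "\<dots> \<le> integral {0..1} (\<lambda>r. um ((1 - l) * s + l * t + d * r))"
  proof (rule integral_le)
    fix r
    show "(1 - l) * u0 (s + d * r) + l * u1 (t + d * r) \<le> um ((1 - l) * s + l * t + d * r)"
      using le[of "s + d * r" "t + d * r"] by (simp add: algebra_simps)
  qed (use c in \<open>auto intro!: moving_avg_integrable Henstock_Kurzweil_Integration.integrable_add integrable_on_mult_right\<close>)
  finally show ?thesis by (simp add: moving_avg_def)
qed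

lemma moving_avg_near:
  assumes u: "continuous_on UNIV u" and d: "0 \<le> d" and near: "\<And>y. \<bar>y - x\<bar> \<le> d \<Longrightarrow> \<bar>u y - b\<bar> \<le> e"
  shows "\<bar>moving_avg d u x - b\<bar> \<le> e"
proof -
  have "moving_avg d u x - b = integral {0..1} (\<lambda>r. u (x + d * r) - b)"
    unfolding moving_avg_def by (subst Henstock_Kurzweil_Integration.integral_diff) (auto intro!: moving_avg_integrable u)
  also have "norm \<dots> \<le> e * (1 - 0)"
  proof (rule integral_bound)
    show "continuous_on {0..1} (\<lambda>r. u (x + d * r) - b)"
      by (intro continuous_intros continuous_on_compose2[OF u]) auto
    fix r :: real assume "r \<in> {0..1}"
    then have "d * r \<le> d" "0 \<le> d * r" using d by (auto intro!: mult_left_le)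
    then show "norm (u (x + d * r) - b) \<le> e" using near[of "x + d * r"] by simp
  qed simp
  finally show ?thesis by simp
qed

lemma moving_avg_twice_tendsto:
  assumes u: "continuous_on UNIV u"
  shows "(\<lambda>n. moving_avg (1 / Suc n) (moving_avg (1 / Suc n) u) x) \<longlonglongrightarrow> u x"
proof (rule LIMSEQ_I)
  fix r :: real assume r: "r > 0"
  have "isCont u x" using u by (simp add: continuous_on_eq_continuous_at)
  then obtain s where s: "s > 0" "\<And>y. \<bar>y - x\<bar> < s \<Longrightarrow> \<bar>u y - u x\<bar> < r / 2"
    using r unfolding continuous_at_eps_delta by (metis half_gt_zero dist_real_def)
  obtain N where N: "1 / Suc N < s / 2"
    using s(1) by (meson half_gt_zero nat_approx_posE)
  show "\<exists>no. \<forall>n\<ge>no. norm (moving_avg (1 / Suc n) (moving_avg (1 / Suc n) u) x - u x) < r"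
  proof (intro exI allI impI)
    fix n assume "n \<ge> N"
    define d where "d = 1 / real (Suc n)"
    have "d \<le> 1 / Suc N" using \<open>n \<ge> N\<close> by (auto simp: d_def field_simps)
    then have d: "0 < d" "2 * d < s" using N by (auto simp: d_def)
    have 1: "\<bar>moving_avg d u y - u x\<bar> \<le> r / 2" if "\<bar>y - x\<bar> \<le> d" for y
    proof (rule moving_avg_near[OF u])
      fix y' assume "\<bar>y' - y\<bar> \<le> d"
      then have "\<bar>y' - x\<bar> < s" using d that by linarith
      then show "\<bar>u y' - u x\<bar> \<le> r / 2" using s(2) by (simp add: less_imp_le)
    qed (use d in simp)
    have "\<bar>moving_avg d (moving_avg d u) x - u x\<bar> \<le> r / 2"
      by (rule moving_avg_near[OF continuous_on_moving_avg[OF u]]) (use d(1) 1 in \<open>simp_all\<close>)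
    then show "norm (moving_avg (1 / Suc n) (moving_avg (1 / Suc n) u) x - u x) < r"
      using r unfolding d_def real_norm_def by linarith
  qed
qed

text \<open>The first derivative is a first difference over d and the second a second difference
  over \<open>d\<^sup>2\<close>, of functions bounded by L; hence \<open>2 * L / d\<close> and
  \<open>4 * L / d\<^sup>2\<close>. The constants depend on L and d alone, so the three flows to be
  compared share them.\<close>

lemma ehrhard_flow_moving_avg_twice:
  assumes u: "continuous_on UNIV u" and b: "\<And>x. \<bar>u x\<bar> \<le> L" and d: "d > 0"
  shows "ehrhard_flow L (max (2 * L / d) (4 * L / d\<^sup>2) / \<phi> L) (flow (moving_avg d (moving_avg d u)))"
proof (rule ehrhard_flow_flow)
  note cb = continuous_on_moving_avg[OF u, of d]
  have d': "d \<noteq> 0" using d by simp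
  have bb: "\<bar>moving_avg d u x\<bar> \<le> L" for x by (rule moving_avg_abs_le[OF u b])
  let ?u' = "\<lambda>x. (moving_avg d u (x + d) - moving_avg d u x) / d"
  let ?u'' = "\<lambda>x. ((u (x + d + d) - u (x + d)) / d - (u (x + d) - u x) / d) / d"
  show "(moving_avg d (moving_avg d u) has_real_derivative ?u' x) (at x)" for x
    using cb d' by (intro DERIV_moving_avg)
  show "(?u' has_real_derivative ?u'' x) (at x)" for x
  proof -
    have "((\<lambda>x. moving_avg d u (x + d)) has_real_derivative (u (x + d + d) - u (x + d)) / d) (at x)"
      using DERIV_moving_avg[OF u d', of "x + d"] by (simp add: DERIV_shift)
    then show ?thesis
      by (intro DERIV_cdivide DERIV_diff DERIV_moving_avg[OF u d'])
  qed
  show "continuous_on UNIV ?u''"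
    by (intro continuous_intros continuous_on_compose2[OF u]) (auto simp: d')
  show "\<bar>moving_avg d (moving_avg d u) x\<bar> \<le> L" for x
    by (rule moving_avg_abs_le) (use cb d' bb in auto)
  show "\<bar>?u' x\<bar> \<le> max (2 * L / d) (4 * L / d\<^sup>2)" for x
  proof -
    have "\<bar>moving_avg d u (x + d) - moving_avg d u x\<bar> \<le> 2 * L" using bb[of x] bb[of "x+d"] by linarith
    then have "\<bar>?u' x\<bar> \<le> 2 * L / d" using d by (simp add: abs_divide divide_right_mono)
    then show ?thesis by simp
  qed
  show "\<bar>?u'' x\<bar> \<le> max (2 * L / d) (4 * L / d\<^sup>2)" for x
  proof -
    have "?u'' x = (u (x + d + d) - u (x + d) - (u (x + d) - u x)) / d\<^sup>2" 
      using d by (simp add: field_simps power2_eq_square)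
    moreover have "\<bar>u (x + d + d) - u (x + d) - (u (x + d) - u x)\<bar> \<le> 4 * L"
      using b[of x] b[of "x+d"] b[of "x+d+d"] by linarith
    ultimately have "\<bar>?u'' x\<bar> \<le> 4 * L / d\<^sup>2" using d by (simp add: abs_divide divide_right_mono)
    then show ?thesis by simp
  qed
qed

text \<open>The expectations are heat flows at time 1 and position 0, so this is the comparison at a
  = 1, s = t = 0 for mollified data, followed by dominated convergence.\<close>

theorem ehrhard_functional_real:
  fixes u0 u1 um :: "real \<Rightarrow> real"
  assumes c: "continuous_on UNIV u0" "continuous_on UNIV u1" "continuous_on UNIV um"
    and b: "\<And>x. \<bar>u0 x\<bar> \<le> L" "\<And>x. \<bar>u1 x\<bar> \<le> L" "\<And>x. \<bar>um x\<bar> \<le> L"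
    and l: "0 < l" "l < 1"
    and le: "\<And>s t. (1 - l) * u0 s + l * u1 t \<le> um ((1 - l) * s + l * t)"
  shows "(1 - l) * probit (gauss.expectation (\<lambda>z. \<Phi> (u0 z))) + l * probit (gauss.expectation (\<lambda>z. \<Phi> (u1 z)))
     \<le> probit (gauss.expectation (\<lambda>z. \<Phi> (um z)))"
proof -
  define bb where "bb = (\<lambda>n u. moving_avg (1 / Suc n) (moving_avg (1 / Suc n) u))"
  have cb: "continuous_on UNIV (bb n u)" if "continuous_on UNIV u" for n u
    unfolding bb_def by (intro continuous_on_moving_avg that) auto
  have lim: "(\<lambda>n. flow (bb n u) 1 0) \<longlonglongrightarrow> probit (gauss.expectation (\<lambda>z. \<Phi> (u z)))"
    if u: "continuous_on UNIV u" "\<And>x. \<bar>u x\<bar> \<le> L" for u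
    unfolding flow_def
  proof (rule tendsto_probit)
    have m: "(\<lambda>z. \<Phi> (v z)) \<in> borel_measurable borel" if "continuous_on UNIV v" for v
      by (intro borel_measurable_continuous_onI continuous_intros that)
    have "(\<lambda>n. gauss.expectation (\<lambda>z. \<Phi> (bb n u z))) \<longlonglongrightarrow> gauss.expectation (\<lambda>z. \<Phi> (u z))"
    proof (rule integral_dominated_convergence[where w="\<lambda>_. 1"])
      show "AE z in std_gauss. (\<lambda>n. \<Phi> (bb n u z)) \<longlonglongrightarrow> \<Phi> (u z)"
        unfolding bb_def by (intro AE_I2 isCont_tendsto_compose[OF isCont_Phi] moving_avg_twice_tendsto u)
      show "(\<lambda>z. \<Phi> (u z)) \<in> borel_measurable std_gauss" "(\<lambda>z. \<Phi> (bb n u z)) \<in> borel_measurable std_gauss" for n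
        using m[OF u(1)] m[OF cb[OF u(1)]] by auto
    qed auto
    then show "(\<lambda>n. heat (\<lambda>y. \<Phi> (bb n u y)) 1 0) \<longlonglongrightarrow> gauss.expectation (\<lambda>z. \<Phi> (u z))"
      by (simp add: heat_def)
    have "\<Phi> (- L) \<le> heat (\<lambda>y. \<Phi> (u y)) 1 0" "heat (\<lambda>y. \<Phi> (u y)) 1 0 \<le> \<Phi> L"
    proof -
      have "- L \<le> u y" "u y \<le> L" for y using u(2)[of y] by linarith+
      then have "\<Phi> (- L) \<le> \<Phi> (u y)" "\<Phi> (u y) \<le> \<Phi> L" for y by auto
      moreover have "continuous_on UNIV (\<lambda>y. \<Phi> (u y))" "\<bar>\<Phi> (u y)\<bar> \<le> 1" for y
        by (auto intro!: continuous_intros u(1))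
      ultimately show "\<Phi> (- L) \<le> heat (\<lambda>y. \<Phi> (u y)) 1 0" "heat (\<lambda>y. \<Phi> (u y)) 1 0 \<le> \<Phi> L"
        using heat_bounds by blast+
    qed
    from probit_bounds[OF this] show "0 < gauss.expectation (\<lambda>z. \<Phi> (u z))" "gauss.expectation (\<lambda>z. \<Phi> (u z)) < 1"
      by (auto simp: heat_def)
  qed
  have "(1 - l) * flow (bb n u0) 1 0 + l * flow (bb n u1) 1 0 \<le> flow (bb n um) 1 ((1 - l) * 0 + l * 0)" for n
  proof -
    have "0 < 1 / real (Suc n)" by simp
    note fl = ehrhard_flow_moving_avg_twice[OF c(1) b(1) this] ehrhard_flow_moving_avg_twice[OF c(2) b(2) this]
      ehrhard_flow_moving_avg_twice[OF c(3) b(3) this]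
    show ?thesis
      unfolding bb_def
    proof (rule ehrhard_flow_comparison[OF fl])
      have nz: "1 / real (Suc n) \<noteq> 0" by simp
      show "(1 - l) * flow (moving_avg (1 / real (Suc n)) (moving_avg (1 / real (Suc n)) u0)) 0 s
        + l * flow (moving_avg (1 / real (Suc n)) (moving_avg (1 / real (Suc n)) u1)) 0 t
        \<le> flow (moving_avg (1 / real (Suc n)) (moving_avg (1 / real (Suc n)) um)) 0 ((1 - l) * s + l * t)" for s t
        unfolding flow_0
        by (intro moving_avg_convex_combination continuous_on_moving_avg c nz le)
    qed (use l in simp_all)
  qed
  then have le': "(1 - l) * flow (bb n u0) 1 0 + l * flow (bb n u1) 1 0 \<le> flow (bb n um) 1 0" for n
    by simp
  show ?thesis
    by (rule LIMSEQ_le[OF tendsto_add[OF tendsto_mult_left[OF lim] tendsto_mult_left[OF lim]] lim])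
       (use b c le' in auto)
qed

subsection \<open>Convex functions of one Gaussian variable\<close>

text \<open>Closed form of E(\<xi> + s)^+ for a standard Gaussian \<xi>;
  \<open>pos_part_square\<close> is the closed form of the second moment of the same
  variable.\<close>

definition pos_part_mean :: "real \<Rightarrow> real" where
  "pos_part_mean s = s * \<Phi> s + \<phi> s"

definition pos_part_square :: "real \<Rightarrow> real" where
  "pos_part_square s = (1 + s\<^sup>2) * \<Phi> s + s * \<phi> s"

abbreviation ramp :: "real \<Rightarrow> real \<Rightarrow> real" where
  "ramp s x \<equiv> indicator {-s<..} x * (x + s)"

lemma gauss_integrable_power: "integrable std_gauss (\<lambda>x. (x + s) ^ n)"
proof -
  have "integrable std_gauss (\<lambda>x. \<Sum>k\<le>n. of_nat (n choose k) * x ^ k * s ^ (n - k))"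
    by (intro Bochner_Integration.integrable_sum integrable_mult_left integrable_mult_right
        integrable_std_normal_distribution_moment)
  then show ?thesis by (simp add: binomial_ring)
qed

lemma gauss_ramp_integral:
  assumes F: "\<And>x. (F has_real_derivative \<phi> x * (x + s) ^ n) (at x)"
    and B: "(F \<longlongrightarrow> B) at_top"
  shows "integrable std_gauss (\<lambda>x. indicator {-s<..} x * (x + s) ^ n)"
    and "gauss.expectation (\<lambda>x. indicator {-s<..} x * (x + s) ^ n) = B - F (- s)"
proof -
  show "integrable std_gauss (\<lambda>x. indicator {-s<..} x * (x + s) ^ n)"
    by (intro integrable_real_mult_indicator[where f="\<lambda>x. (x + s) ^ n", unfolded mult.commute[of _ "indicator _ _"]] gauss_integrable_power) simp
  have "continuous_on UNIV F"
    using F by (meson DERIV_isCont continuous_at_imp_continuous_on)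
  then have "isCont F (- s)" by (simp add: continuous_on_eq_continuous_at)
  then have "(F \<longlongrightarrow> F (- s)) (at_right (- s))"
    unfolding isCont_def by (rule filterlim_mono) (auto simp: at_le)
  then have "gauss.expectation (\<lambda>x. indicator (einterval (ereal (- s)) \<infinity>) x * (x + s) ^ n) = B - F (- s)"
    using B F gauss_integrable_power
    by (intro gauss_FTC[where F=F]) (auto intro!: continuous_intros simp: ereal_tendsto_simps simp del: uminus_ereal.simps)
  then show "gauss.expectation (\<lambda>x. indicator {-s<..} x * (x + s) ^ n) = B - F (- s)"
    by simp
qed

lemma ramp_power_0:
  "gauss.expectation (indicator {-s<..}) = \<Phi> s" 
proof -
  have "gauss.expectation (\<lambda>x. indicator {-s<..} x * (x + s) ^ 0) = 1 - \<Phi> (- s)"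
    by (rule gauss_ramp_integral) (auto intro!: derivative_eq_intros Phi_tendsto_at_top)
  then show ?thesis by (simp add: Phi_minus)
qed

lemma ramp_integrable [simp]: "integrable std_gauss (ramp s)"
  and ramp_expectation: "gauss.expectation (ramp s) = pos_part_mean s"
proof -
  have *: "((\<lambda>x. s * \<Phi> x - \<phi> x) has_real_derivative \<phi> x * (x + s) ^ 1) (at x)" for x
    by (auto intro!: derivative_eq_intros simp: algebra_simps)
  have **: "((\<lambda>x. s * \<Phi> x - \<phi> x) \<longlongrightarrow> s * 1 - 0) at_top"
    by (intro tendsto_intros Phi_tendsto_at_top phi_tendsto_at_top)
  show "integrable std_gauss (ramp s)" "gauss.expectation (ramp s) = pos_part_mean s"
    using gauss_ramp_integral[OF * **] by (auto simp: pos_part_mean_def Phi_minus algebra_simps)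
qed

lemma ramp_square_integrable [simp]: "integrable std_gauss (\<lambda>x. (ramp s x)\<^sup>2)"
  and ramp_square_expectation: "gauss.expectation (\<lambda>x. (ramp s x)\<^sup>2) = pos_part_square s"
proof -
  have *: "((\<lambda>x. (1 + s\<^sup>2) * \<Phi> x - (x + 2 * s) * \<phi> x) has_real_derivative \<phi> x * (x + s) ^ 2) (at x)" for x
    by (auto intro!: derivative_eq_intros simp: algebra_simps power2_eq_square)
  have "((\<lambda>x. (x + 2 * s) * \<phi> x) \<longlongrightarrow> 0) at_top"
    unfolding std_normal_density_def by real_asymp
  then have **: "((\<lambda>x. (1 + s\<^sup>2) * \<Phi> x - (x + 2 * s) * \<phi> x) \<longlongrightarrow> (1 + s\<^sup>2) * 1 - 0) at_top"
    by (intro tendsto_intros Phi_tendsto_at_top)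
  have ***: "(ramp s x)\<^sup>2 = indicator {-s<..} x * (x + s)\<^sup>2" for x
    by (simp add: indicator_def)
  show "integrable std_gauss (\<lambda>x. (ramp s x)\<^sup>2)" "gauss.expectation (\<lambda>x. (ramp s x)\<^sup>2) = pos_part_square s"
    unfolding *** using gauss_ramp_integral[OF * **] by (auto simp: pos_part_square_def Phi_minus algebra_simps)
qed

lemma DERIV_pos_part_mean: "(pos_part_mean has_real_derivative \<Phi> x) (at x)"
  unfolding pos_part_mean_def[abs_def] by (auto intro!: derivative_eq_intros)

lemma DERIV_pos_part_square: "(pos_part_square has_real_derivative 2 * pos_part_mean x) (at x)"
  unfolding pos_part_mean_def pos_part_square_def[abs_def]
  by (auto intro!: derivative_eq_intros simp: algebra_simps power2_eq_square)

lemma pos_part_mean_pos: "0 < pos_part_mean s"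
proof -
  have "0 \<le> gauss.expectation (ramp (s - 1))"
    by (rule integral_nonneg_AE) (auto simp: indicator_def)
  then have "0 \<le> pos_part_mean (s - 1)" by (simp only: ramp_expectation)
  also have "\<dots> < pos_part_mean s"
    by (rule DERIV_pos_imp_increasing[where f=pos_part_mean]) (use DERIV_pos_part_mean in \<open>auto intro!: exI\<close>)
  finally show ?thesis .
qed

lemma pos_part_square_nonneg: "0 \<le> pos_part_square s"
  unfolding ramp_square_expectation[symmetric] by simp

text \<open>Cauchy--Schwarz on the event where the ramp does not vanish.\<close>

lemma pos_part_variance: "(pos_part_mean s)\<^sup>2 \<le> \<Phi> s * pos_part_square s"
proof -
  define c where "c = pos_part_mean s / \<Phi> s"
  have "0 \<le> gauss.expectation (\<lambda>x. (ramp s x - c * indicator {-s<..} x)\<^sup>2)"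
    by simp
  also have "(\<lambda>x. (ramp s x - c * indicator {-s<..} x)\<^sup>2) = 
     (\<lambda>x. (ramp s x)\<^sup>2 - 2 * c * ramp s x + c\<^sup>2 * indicator {-s<..} x)"
    by (auto simp: indicator_def power2_eq_square algebra_simps)
  also have "gauss.expectation \<dots> = pos_part_square s - 2 * c * pos_part_mean s + c\<^sup>2 * \<Phi> s"
  proof -
    have "integrable std_gauss (indicator {-s<..} :: real \<Rightarrow> real)"
      by (rule gauss_integrable_bounded[where B=1]) (auto simp: indicator_def)
    then show ?thesis
      by (simp add: ramp_expectation ramp_square_expectation ramp_power_0[simplified])
  qed
  also have "\<dots> = pos_part_square s - (pos_part_mean s)\<^sup>2 / \<Phi> s"
    by (simp add: c_def power2_eq_square)
  finally show ?thesis by (simp add: field_simps)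
qed

lemma nonneg_of_mono_limit_at_bot:
  fixes h h' :: "real \<Rightarrow> real"
  assumes "\<And>x. x \<le> b \<Longrightarrow> (h has_real_derivative h' x) (at x)" "\<And>x. x \<le> b \<Longrightarrow> 0 \<le> h' x"
    and lim: "(h \<longlongrightarrow> 0) at_bot"
  shows "0 \<le> h b"
proof (rule tendsto_upperbound[OF lim])
  show "\<forall>\<^sub>F x in at_bot. h x \<le> h b"
    using eventually_le_at_bot[of b]
  proof eventually_elim
    case (elim x)
    then show ?case
      by (intro deriv_nonneg_imp_mono[where g=h and g'=h']) (use assms in auto)
  qed
qed simp

section \<open>Mills-ratio estimates and the tail inequality for the ramp\<close>

text \<open>Komatsu's upper bound for the Mills ratio. The difference of the two sides vanishes at
  -\<infinity> and is nondecreasing on the negative half-line, where the sign of its derivative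
  comes down to \<open>x\<^sup>2 * (x\<^sup>2 + 2) \<le> (x\<^sup>2 + 1)\<^sup>2\<close>.\<close>

lemma Phi_le_Komatsu:
  assumes "s \<le> 0" shows "\<Phi> s \<le> \<phi> s * (sqrt (s\<^sup>2 + 2) + s)"
proof -
  let ?r = "\<lambda>x::real. sqrt (x\<^sup>2 + 2)"
  have "0 \<le> \<phi> s * (?r s + s) - \<Phi> s"
  proof (rule nonneg_of_mono_limit_at_bot[where b=s and h="\<lambda>x. \<phi> x * (?r x + x) - \<Phi> x" and
      h'="\<lambda>x. \<phi> x * (- x) * (?r x + x - inverse (?r x))"])
    fix x :: real assume x: "x \<le> s"
    have pos: "x\<^sup>2 + 2 > 0" by (simp add: add_nonneg_pos)
    show "((\<lambda>x. \<phi> x * (?r x + x) - \<Phi> x) has_real_derivative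
        \<phi> x * (- x) * (?r x + x - inverse (?r x))) (at x)"
      using pos by (auto intro!: derivative_eq_intros simp: field_simps power2_eq_square)
    have "- x * ?r x \<le> x\<^sup>2 + 1"
    proof -
      have "(- x * ?r x)\<^sup>2 \<le> (x\<^sup>2 + 1)\<^sup>2"
        using pos by (simp add: power_mult_distrib power2_eq_square algebra_simps)
      then show ?thesis by (rule power2_le_imp_le) simp
    qed
    then have "0 \<le> (?r x + x - inverse (?r x)) * ?r x"
      using pos by (simp add: algebra_simps less_imp_le)
    then have "0 \<le> ?r x + x - inverse (?r x)"
      using pos by (simp add: zero_le_mult_iff not_le)
    then show "0 \<le> \<phi> x * (- x) * (?r x + x - inverse (?r x))"
      using x assms by (intro mult_nonneg_nonneg) auto
  next
    have "((\<lambda>x. \<phi> x * (?r x + x)) \<longlongrightarrow> 0) at_bot"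
      unfolding std_normal_density_def by real_asymp
    from tendsto_diff[OF this Phi_tendsto_at_bot]
    show "((\<lambda>x. \<phi> x * (?r x + x) - \<Phi> x) \<longlongrightarrow> 0) at_bot" by simp
  qed
  then show ?thesis by simp
qed

text \<open>As a quadratic in \<open>\<Phi> s\<close> the claim is \<Phi>^2 - 2 s \<phi> \<Phi> - 2
  \<phi>^2 \<le> 0, whose positive root is Komatsu's bound; the proof multiplies out the two root
  factors.\<close>

lemma Phi_square_le:
  assumes "s \<le> 0" shows "(\<Phi> s)\<^sup>2 \<le> 2 * \<phi> s * pos_part_mean s"
proof -
  let ?r = "sqrt (s\<^sup>2 + 2)"
  have r2: "?r * ?r = s\<^sup>2 + 2" by (simp add: add_nonneg_pos less_imp_le)
  have "0 \<le> (\<phi> s * (?r + s) - \<Phi> s) * (\<phi> s * (?r - s) + \<Phi> s)"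
  proof (intro mult_nonneg_nonneg)
    show "0 \<le> \<phi> s * (?r + s) - \<Phi> s" using Phi_le_Komatsu[OF assms] by simp
    have "0 \<le> \<phi> s * (?r - s)" using assms by (intro mult_nonneg_nonneg) (auto intro: order_trans[of _ 0])
    then show "0 \<le> \<phi> s * (?r - s) + \<Phi> s" by simp
  qed
  also have "\<dots> = (\<phi> s)\<^sup>2 * (?r * ?r - s\<^sup>2) + 2 * s * \<phi> s * \<Phi> s - (\<Phi> s)\<^sup>2"
    by (simp add: algebra_simps power2_eq_square)
  also have "\<dots> = 2 * \<phi> s * pos_part_mean s - (\<Phi> s)\<^sup>2"
    unfolding r2 pos_part_mean_def by (simp add: algebra_simps power2_eq_square)
  finally show ?thesis by simp
qed

text \<open>Combines 1 / sqrt (2 pi) \<le> 2/5, from 2 pi \<ge> 25/4, with exp(-y) (1 + y) \<le> 1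
  at y = x^2 / 2.\<close>

lemma phi_le_04: "\<phi> x * (1 + x\<^sup>2 / 2) \<le> 4 / 10"
proof -
  have "(5/2)\<^sup>2 \<le> 2 * pi" using pi_approx by (simp add: power2_eq_square)
  then have "5/2 \<le> sqrt (2 * pi)" by (rule real_le_rsqrt)
  then have "1 / sqrt (2 * pi) \<le> 1 / (5/2)" by (intro divide_left_mono) auto
  moreover have "exp (- x\<^sup>2 / 2) * (1 + x\<^sup>2 / 2) \<le> 1"
    using exp_ge_add_one_self[of "x\<^sup>2 / 2"] by (simp add: exp_minus field_simps)
  ultimately have "1 / sqrt (2 * pi) * (exp (- x\<^sup>2 / 2) * (1 + x\<^sup>2 / 2)) \<le> 1 / (5/2) * 1"
    by (intro mult_mono) auto
  then show ?thesis by (simp add: std_normal_density_def mult.assoc)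
qed

lemma Phi_le_linear:
  assumes "0 \<le> s" shows "\<Phi> s \<le> 1/2 + 4 / 10 * s"
proof -
  have "\<Phi> 0 = 1/2" using Phi_minus[of 0] by simp
  moreover have "1/2 + 4 / 10 * 0 - \<Phi> 0 \<le> 1/2 + 4 / 10 * s - \<Phi> s"
  proof (rule deriv_nonneg_imp_mono[where g="\<lambda>s. 1/2 + 4 / 10 * s - \<Phi> s" and g'="\<lambda>s. 4/10 - \<phi> s"])
    fix x :: real
    show "((\<lambda>s. 1/2 + 4 / 10 * s - \<Phi> s) has_real_derivative 4/10 - \<phi> x) (at x)"
      by (auto intro!: derivative_eq_intros)
    have "\<phi> x * 1 \<le> \<phi> x * (1 + x\<^sup>2 / 2)" by (intro mult_left_mono) auto
    then show "0 \<le> 4/10 - \<phi> x" using phi_le_04[of x] by linarith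
  qed (use assms in auto)
  ultimately show ?thesis by simp
qed

text \<open>After collecting the terms in \<open>\<phi> s\<close> the claim is \<phi> (2 \<Phi> - 1)
  \<le> 2 q s \<Phi> with q = \<Phi>(-s), and the linear bound on \<Phi> gives 2 \<Phi> - 1 \<le>
  (8/10) s.\<close>

lemma phi_le_tail_mean:
  assumes "0 \<le> s" shows "\<phi> s \<le> 2 * \<Phi> (- s) * pos_part_mean s"
proof -
  let ?q = "\<Phi> (- s)"
  have q: "?q = 1 - \<Phi> s" by (rule Phi_minus)
  have lin: "\<Phi> s \<le> 1/2 + 4 / 10 * s" using assms by (rule Phi_le_linear)
  have half: "1/2 \<le> \<Phi> s" 
  proof -
    have "\<Phi> 0 \<le> \<Phi> s" using assms by simp
    moreover have "\<Phi> 0 = 1/2" using Phi_minus[of 0] by simp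
    ultimately show ?thesis by linarith
  qed
  have "\<phi> s * (2 * \<Phi> s - 1) \<le> 2 * ?q * s * \<Phi> s"
  \<comment> \<open>The threshold is twice the slope 4/10: above it (8/10) s \<le> s^2, and a lower
    Mills bound, from the second moment of the ramp at -s being nonnegative, finishes. Below it the
    factor s cancels and explicit polynomial bounds suffice.\<close>
  proof (cases "s \<ge> 8 / 10")
    case True
    have "0 \<le> pos_part_square (- s)" by (rule pos_part_square_nonneg)
    then have mills: "s * \<phi> s \<le> (1 + s\<^sup>2) * ?q" by (simp add: pos_part_square_def)
    have "8 / 10 * s \<le> s * s" using True by (intro mult_right_mono) auto
    then have "2 * \<Phi> s \<le> 1 + s\<^sup>2" using lin by (simp add: power2_eq_square)
    then have "(2 * \<Phi> s - 1) * (1 + s\<^sup>2) \<le> 2 * s\<^sup>2 * \<Phi> s" by (simp add: algebra_simps)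
    then have "\<phi> s * ((2 * \<Phi> s - 1) * (1 + s\<^sup>2)) \<le> \<phi> s * (2 * s\<^sup>2 * \<Phi> s)"
      by (intro mult_left_mono) auto
    also have "\<dots> = 2 * s * \<Phi> s * (s * \<phi> s)" by (simp add: power2_eq_square)
    also have "\<dots> \<le> 2 * s * \<Phi> s * ((1 + s\<^sup>2) * ?q)"
      using mills assms by (intro mult_left_mono) auto
    finally have "\<phi> s * (2 * \<Phi> s - 1) * (1 + s\<^sup>2) \<le> 2 * ?q * s * \<Phi> s * (1 + s\<^sup>2)"
      by (simp add: algebra_simps)
    then show ?thesis by (simp add: add_nonneg_pos power2_eq_square mult_le_cancel_right)
       (smt (verit) zero_le_square)
  next
    case False
    then have s2: "s\<^sup>2 \<le> 64 / 100" using assms power_mono[of s "8/10" 2] by (simp add: power2_eq_square)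
    have "s\<^sup>2 * s\<^sup>2 \<le> 64/100 * (64 / 100)" using s2 by (intro mult_mono) auto
    then have poly: "4/10 * (8/10) \<le> (1/2 - 32/100 * s\<^sup>2) * (1 + s\<^sup>2 / 2)"
    proof -
      have "(1/2 - 32/100 * s\<^sup>2) * (1 + s\<^sup>2 / 2) = 1/2 - 7/100 * s\<^sup>2 - 16/100 * (s\<^sup>2 * s\<^sup>2)"
        by (simp add: algebra_simps)
      then show ?thesis using s2 \<open>s\<^sup>2 * s\<^sup>2 \<le> 64/100 * (64 / 100)\<close> by linarith
    qed
    have "\<phi> s * (8/10) * (1 + s\<^sup>2 / 2) \<le> 4/10 * (8/10)" using phi_le_04[of s] by (simp add: algebra_simps)
    with poly have "\<phi> s * (8/10) * (1 + s\<^sup>2 / 2) \<le> (1/2 - 32/100 * s\<^sup>2) * (1 + s\<^sup>2 / 2)" by linarith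
    then have 1: "\<phi> s * (8/10) \<le> 1/2 - 32/100 * s\<^sup>2"
      by (rule mult_right_le_imp_le) (simp add: add_pos_nonneg)
    have "(\<Phi> s - 1/2)\<^sup>2 \<le> (4/10 * s)\<^sup>2" using lin half by (intro power_mono) auto
    \<comment> \<open>Here \<open>?q * \<Phi> s\<close> equals 1/4 - (\<Phi> s - 1/2)^2, because the
      two factors sum to 1.\<close>
    then have 2: "1/4 - 16/100 * s\<^sup>2 \<le> ?q * \<Phi> s" 
      unfolding q by (simp add: power2_eq_square algebra_simps)
    have "\<phi> s * (2 * \<Phi> s - 1) \<le> \<phi> s * (8/10 * s)" using lin by (intro mult_left_mono) auto
    also have "\<dots> = \<phi> s * (8/10) * s" by simp
    also have "\<dots> \<le> 2 * (?q * \<Phi> s) * s"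
    proof (rule mult_right_mono)
      show "\<phi> s * (8/10) \<le> 2 * (?q * \<Phi> s)" using 1 2 by linarith
    qed fact
    finally show ?thesis by (simp add: mult_ac)
  qed
  then show ?thesis unfolding pos_part_mean_def q by (simp add: algebra_simps)
qed

lemma pos_part_variance_pos: "(pos_part_mean s)\<^sup>2 < pos_part_square s"
proof -
  have "(pos_part_mean s)\<^sup>2 \<le> \<Phi> s * pos_part_square s" by (rule pos_part_variance)
  moreover have "pos_part_square s > 0"
    using pos_part_variance[of s] pos_part_mean_pos[of s]
    by (smt (verit) Phi_pos zero_less_mult_iff zero_less_power)
  then have "\<Phi> s * pos_part_square s < 1 * pos_part_square s" by (intro mult_strict_right_mono) auto
  ultimately show ?thesis by simp
qed

text \<open>Equivalent to the nonnegativity of the derivative of -2 ln \<Phi>(-s) - A^2 / V, where A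
  and V are the mean and the variance of the ramp. Multiplication by \<Phi>^2 makes both sides
  polynomials in A, \<Phi>, \<phi>, q = \<Phi>(-s) and N, the defect in the Cauchy--Schwarz bound on
  A^2.\<close>

lemma pos_part_derivative_bound:
  defines "A \<equiv> pos_part_mean" and "V \<equiv> \<lambda>s. pos_part_square s - (pos_part_mean s)\<^sup>2"
  shows "A s * (\<Phi> s * pos_part_square s - (A s)\<^sup>2) * \<Phi> (- s) \<le> \<phi> s * (V s)\<^sup>2"
proof -
  let ?q = "\<Phi> (- s)"
  define N where "N = \<Phi> s * pos_part_square s - (A s)\<^sup>2"
  have N: "N \<ge> 0" using pos_part_variance[of s] by (simp add: N_def A_def)
  have N': "N = (\<Phi> s)\<^sup>2 - \<phi> s * A s"
    by (simp add: N_def A_def pos_part_mean_def pos_part_square_def algebra_simps power2_eq_square)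
  have A: "A s > 0" by (simp add: A_def pos_part_mean_pos)
  have VN: "\<Phi> s * V s = N + ?q * (A s)\<^sup>2"
    by (simp add: V_def N_def A_def Phi_minus algebra_simps)
  \<comment> \<open>Multiplied by N, the right-hand side is \<phi> (N + q A^2)^2 without its last
    square, and \<Phi> V = N + q A^2. So this linear bound in N is enough; the two Mills-type
    estimates cover one sign of s each.\<close>
  have key: "(\<Phi> s)\<^sup>2 * A s * ?q \<le> \<phi> s * N + 2 * \<phi> s * ?q * (A s)\<^sup>2"
  proof (cases "0 \<le> s")
    case True
    have "s * ?q \<le> \<phi> s" using pos_part_mean_pos[of "-s"] by (simp add: pos_part_mean_def)
    then have "\<Phi> s * (s * ?q) \<le> \<Phi> s * \<phi> s" by (intro mult_left_mono) auto
    then have "A s * ?q \<le> \<phi> s" by (simp add: A_def pos_part_mean_def Phi_minus algebra_simps)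
    then have "(\<Phi> s)\<^sup>2 * (A s * ?q) \<le> (\<Phi> s)\<^sup>2 * \<phi> s" by (intro mult_left_mono) auto
    moreover have "\<phi> s * (\<phi> s * A s) \<le> 2 * ?q * A s * (\<phi> s * A s)"
      using phi_le_tail_mean[OF True] A by (intro mult_right_mono) (auto simp: A_def)
    moreover have "\<phi> s * N + 2 * \<phi> s * ?q * (A s)\<^sup>2 - (\<Phi> s)\<^sup>2 * A s * ?q =
      ((\<Phi> s)\<^sup>2 * \<phi> s - (\<Phi> s)\<^sup>2 * (A s * ?q)) + (2 * ?q * A s * (\<phi> s * A s) - \<phi> s * (\<phi> s * A s))"
      unfolding N' by (simp add: algebra_simps power2_eq_square)
    ultimately show ?thesis by linarith
  next
    case False
    then have "(\<Phi> s)\<^sup>2 * (A s * ?q) \<le> 2 * \<phi> s * A s * (A s * ?q)"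
      using Phi_square_le[of s] A by (intro mult_right_mono) (auto simp: A_def)
    moreover have "0 \<le> \<phi> s * N" using N by simp
    ultimately show ?thesis by (simp add: algebra_simps power2_eq_square)
  qed
  have "(\<Phi> s)\<^sup>2 * (A s * N * ?q) = N * ((\<Phi> s)\<^sup>2 * A s * ?q)" by (simp add: mult_ac)
  also have "\<dots> \<le> N * (\<phi> s * N + 2 * \<phi> s * ?q * (A s)\<^sup>2)" using key N by (rule mult_left_mono)
  also have "\<dots> \<le> \<phi> s * (N + ?q * (A s)\<^sup>2)\<^sup>2"
    using A by (simp add: power2_eq_square algebra_simps less_imp_le)
  also have "\<dots> = (\<Phi> s)\<^sup>2 * (\<phi> s * (V s)\<^sup>2)" 
    unfolding VN[symmetric] by (simp add: power_mult_distrib)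
  finally have "A s * N * ?q \<le> \<phi> s * (V s)\<^sup>2"
    by (rule mult_left_le_imp_le) simp
  then show ?thesis by (simp add: N_def)
qed

text \<open>The ramp vanishes with probability \<Phi>(-s), and 0 lies t = A / sqrt V standard
  deviations below its mean A. The inequality says that this probability is at most exp(-t^2 /
  2).\<close>

theorem pos_part_mean_square_le:
  "(pos_part_mean s)\<^sup>2 \<le> - 2 * ln (\<Phi> (- s)) * (pos_part_square s - (pos_part_mean s)\<^sup>2)"
proof -
  define V where "V = (\<lambda>s. pos_part_square s - (pos_part_mean s)\<^sup>2)"
  have V: "V s > 0" for s using pos_part_variance_pos[of s] by (simp add: V_def)
  let ?h = "\<lambda>s. - 2 * ln (\<Phi> (- s)) - (pos_part_mean s)\<^sup>2 / V s"
  let ?N = "\<lambda>s. \<Phi> s * pos_part_square s - (pos_part_mean s)\<^sup>2"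
  let ?h' = "\<lambda>s. 2 * \<phi> s / \<Phi> (- s) - 2 * pos_part_mean s * ?N s / (V s)\<^sup>2"
  have "0 \<le> ?h s"
  proof (rule nonneg_of_mono_limit_at_bot[where b=s and h="?h" and h'="?h'"])
    fix x
    have dV: "(V has_real_derivative 2 * pos_part_mean x * \<Phi> (- x)) (at x)"
      unfolding V_def
      by (auto intro!: derivative_eq_intros DERIV_pos_part_mean DERIV_pos_part_square 
         simp: Phi_minus algebra_simps)
    have dR: "((\<lambda>s. (pos_part_mean s)\<^sup>2 / V s) has_real_derivative 2 * pos_part_mean x * ?N x / (V x)\<^sup>2) (at x)"
      using V[of x]
      by (auto intro!: derivative_eq_intros dV DERIV_pos_part_mean)
         (simp add: V_def Phi_minus field_simps power2_eq_square)
    have "((\<lambda>s. - 2 * ln (\<Phi> (- s))) has_real_derivative 2 * \<phi> x / \<Phi> (- x)) (at x)"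
      by (auto intro!: derivative_eq_intros)
    from DERIV_diff[OF this dR] show "(?h has_real_derivative ?h' x) (at x)" .
    show "0 \<le> ?h' x"
      using pos_part_derivative_bound[of x] V[of x]
      by (simp add: field_simps V_def)
  next
    have q: "((\<lambda>s. \<Phi> (- s)) \<longlongrightarrow> 1) at_bot"
      unfolding Phi_minus using tendsto_diff[OF tendsto_const Phi_tendsto_at_bot, of 1] by simp
    have "((\<lambda>s. - 2 * ln (\<Phi> (- s))) \<longlongrightarrow> - 2 * ln 1) at_bot"
      by (intro tendsto_intros q) auto
    \<comment> \<open>The Cauchy--Schwarz bound A^2 \<le> \<Phi>(s) E(ramp^2) rearranges to A^2 / V
      \<le> \<Phi>(s) / \<Phi>(-s), which tends to 0.\<close>
    moreover have "((\<lambda>s. (pos_part_mean s)\<^sup>2 / V s) \<longlongrightarrow> 0) at_bot"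
    proof (rule Lim_null_comparison)
      show "\<forall>\<^sub>F s in at_bot. norm ((pos_part_mean s)\<^sup>2 / V s) \<le> \<Phi> s / \<Phi> (- s)"
      proof (intro always_eventually allI)
        fix s
        have "\<Phi> (- s) * (pos_part_mean s)\<^sup>2 \<le> \<Phi> s * V s"
          using pos_part_variance[of s] by (simp add: V_def Phi_minus algebra_simps)
        then show "norm ((pos_part_mean s)\<^sup>2 / V s) \<le> \<Phi> s / \<Phi> (- s)"
          using V[of s] by (simp add: field_simps)
      qed
      show "((\<lambda>s. \<Phi> s / \<Phi> (- s)) \<longlongrightarrow> 0) at_bot"
        using tendsto_divide[OF Phi_tendsto_at_bot q] by simp
    qed
    ultimately show "(?h \<longlongrightarrow> 0) at_bot" using tendsto_diff by fastforce
  qed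
  then have "(pos_part_mean s)\<^sup>2 / V s \<le> - 2 * ln (\<Phi> (- s))" by simp
  then show ?thesis using V[of s] by (simp add: field_simps V_def)
qed

section \<open>Extremality of the ramp and the one-dimensional tail bound\<close>

lemma gauss_prob_atMost: "gauss.prob {..b} = \<Phi> b"
  by (simp add: \<Phi>_def cdf_def)

lemma gauss_prob_greaterThan: "gauss.prob {b<..} = \<Phi> (- b)"
proof -
  have "gauss.prob (space std_gauss - {..b}) = 1 - gauss.prob {..b}"
    by (rule gauss.prob_compl) simp
  moreover have "space std_gauss - {..b} = {b<..}" by auto
  ultimately show ?thesis by (simp only: gauss_prob_atMost Phi_minus)
qed

lemma gauss_integrable_of_square:
  fixes f :: "real \<Rightarrow> real"
  assumes [measurable]: "f \<in> borel_measurable borel" and "integrable std_gauss (\<lambda>x. (f x)\<^sup>2)"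
  shows "integrable std_gauss f"
  by (rule gauss.square_integrable_imp_integrable) (use assms in simp_all)

lemma gauss_integrable_mult:
  fixes f g :: "real \<Rightarrow> real"
  assumes [measurable]: "f \<in> borel_measurable borel" "g \<in> borel_measurable borel"
    and "integrable std_gauss (\<lambda>x. (f x)\<^sup>2)" "integrable std_gauss (\<lambda>x. (g x)\<^sup>2)"
  shows "integrable std_gauss (\<lambda>x. f x * g x)"
proof (rule Bochner_Integration.integrable_bound)
  show "integrable std_gauss (\<lambda>x. (f x)\<^sup>2 + (g x)\<^sup>2)" using assms by auto
  have "\<bar>f x * g x\<bar> \<le> (f x)\<^sup>2 + (g x)\<^sup>2" for x
  proof -
    have "2 * (\<bar>f x\<bar> * \<bar>g x\<bar>) \<le> (f x)\<^sup>2 + (g x)\<^sup>2"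
      using sum_squares_bound[of "\<bar>f x\<bar>" "\<bar>g x\<bar>"] by (simp only: mult.assoc power2_abs)
    moreover have "0 \<le> \<bar>f x\<bar> * \<bar>g x\<bar>" by simp
    ultimately show ?thesis unfolding abs_mult by linarith
  qed
  then show "AE x in std_gauss. norm (f x * g x) \<le> norm ((f x)\<^sup>2 + (g x)\<^sup>2)"
    by (intro AE_I2) simp
qed simp

text \<open>Equality holds for the ramp. By monotonicity of the ratio of \<open>X\<close> to the ramp \<open>w\<close>, the
  functions \<open>X - r w\<close> and \<open>w - \<theta>\<close> change sign at the same point.\<close>

lemma second_moment_ge_ramp:
  fixes X :: "real \<Rightarrow> real"
  assumes [measurable]: "X \<in> borel_measurable borel"
    and X2: "integrable std_gauss (\<lambda>x. (X x)\<^sup>2)"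
    and nonneg: "\<And>x. 0 \<le> X x"
    and zero: "\<And>x. x \<le> - s \<Longrightarrow> X x = 0"
    and mono: "\<And>x y. - s < x \<Longrightarrow> x < y \<Longrightarrow> X x * (y + s) \<le> X y * (x + s)"
  shows "(gauss.expectation X)\<^sup>2 * pos_part_square s
     \<le> (pos_part_mean s)\<^sup>2 * gauss.expectation (\<lambda>x. (X x)\<^sup>2)"
proof -
  \<comment> \<open>The multiple r w of the ramp has the same mean as X, so any constant may be
    subtracted from w when integrating against X - r w.\<close>
  define r where "r = gauss.expectation X / pos_part_mean s"
  have A: "pos_part_mean s > 0" by (rule pos_part_mean_pos)
  define w where "w = ramp s"
  have [measurable]: "w \<in> borel_measurable borel" unfolding w_def by measurable
  have w1: "w x = x + s" if "- s < x" for x using that by (simp add: w_def)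
  have w0: "w x = 0" if "x \<le> - s" for x using that by (simp add: w_def)
  have iw: "integrable std_gauss w" "integrable std_gauss (\<lambda>x. (w x)\<^sup>2)"
    unfolding w_def by (rule ramp_integrable ramp_square_integrable)+
  have Ew: "gauss.expectation w = pos_part_mean s" "gauss.expectation (\<lambda>x. (w x)\<^sup>2) = pos_part_square s"
    unfolding w_def by (rule ramp_expectation ramp_square_expectation)+
  have iX: "integrable std_gauss X" by (rule gauss_integrable_of_square) (use X2 in auto)
  have iXw: "integrable std_gauss (\<lambda>x. X x * w x)"
    by (rule gauss_integrable_mult) (use X2 iw in auto)
  note int = iX iXw X2 iw
  have mean0: "gauss.expectation (\<lambda>x. X x - r * w x) = 0"
    using A int by (simp add: Ew r_def)
  have key: "r * pos_part_square s \<le> gauss.expectation (\<lambda>x. X x * w x)"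
  proof (cases "\<exists>x>-s. r * (x + s) \<le> X x")
    case True
    define T where "T = {x. x > - s \<and> r * (x + s) \<le> X x}"
    \<comment> \<open>The value of w at the crossing point: monotonicity of the ratio makes T upward
      closed, so X - r w changes sign once, from negative to nonnegative, and w - \<theta> does so
      at the same place.\<close>
    define \<theta> where "\<theta> = Inf ((\<lambda>x. x + s) ` T)"
    have bdd: "bdd_below ((\<lambda>x. x + s) ` T)" unfolding T_def by (rule bdd_belowI[of _ 0]) auto
    have \<theta>: "0 \<le> \<theta>"
      unfolding \<theta>_def using True by (intro cINF_greatest) (auto simp: T_def)
    have "0 \<le> (X x - r * w x) * (w x - \<theta>)" for x
    proof (cases "x > - s")
      case xs: True
      then have rx: "w x = x + s" by (rule w1)
      show ?thesis
      proof (cases "x \<in> T")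
        case True
        then have "\<theta> \<le> x + s" unfolding \<theta>_def using bdd by (intro cINF_lower)
        then show ?thesis using True unfolding rx by (intro mult_nonneg_nonneg) (auto simp: T_def)
      next
        case False
        then have lt: "X x < r * (x + s)" using xs by (auto simp: T_def)
        have "x + s \<le> y + s" if "y \<in> T" for y
        proof (rule ccontr)
          assume "\<not> x + s \<le> y + s"
          then have "y < x" by simp
          have y: "- s < y" "r * (y + s) \<le> X y" using that by (auto simp: T_def)
          have "r * (y + s) * (x + s) \<le> X y * (x + s)" using y xs by (intro mult_right_mono) auto
          also have "\<dots> \<le> X x * (y + s)" using mono[OF y(1) \<open>y < x\<close>] .
          also have "\<dots> < r * (x + s) * (y + s)" using lt y by (intro mult_strict_right_mono) auto
          finally show False by (simp add: mult_ac)
        qed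
        moreover have "T \<noteq> {}" using \<open>\<exists>x>-s. r * (x + s) \<le> X x\<close> by (auto simp: T_def)
        ultimately have "x + s \<le> \<theta>" unfolding \<theta>_def by (intro cINF_greatest)
        then show ?thesis using lt unfolding rx by (intro mult_nonpos_nonpos) auto
      qed
    next
      case False
      then show ?thesis using zero[of x] w0[of x] by simp
    qed
    then have "0 \<le> gauss.expectation (\<lambda>x. (X x - r * w x) * (w x - \<theta>))"
      by (intro integral_nonneg_AE AE_I2)
    also have "(\<lambda>x. (X x - r * w x) * (w x - \<theta>)) = 
       (\<lambda>x. X x * w x - r * (w x)\<^sup>2 - \<theta> * (X x - r * w x))"
      by (rule ext) (simp add: algebra_simps power2_eq_square)
    also have "gauss.expectation \<dots> = gauss.expectation (\<lambda>x. X x * w x) - r * pos_part_square s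
        - \<theta> * gauss.expectation (\<lambda>x. X x - r * w x)"
    proof -
      have "integrable std_gauss (\<lambda>x. X x - r * w x)" using int by auto
      then show ?thesis using int
        by (subst Bochner_Integration.integral_diff, simp, simp)
           (subst Bochner_Integration.integral_diff, simp_all add: Ew)
    qed
    finally show ?thesis using mean0 by simp
  next
    case False
    \<comment> \<open>Without a crossing X lies below r w everywhere while the means agree, so the
      two coincide almost everywhere.\<close>
    have le: "X x \<le> r * w x" for x
      using False zero[of x] w0[of x] w1[of x] by (cases "x > - s") (auto simp: not_le less_imp_le)
    have "integrable std_gauss (\<lambda>x. r * w x - X x)" using int by auto
    moreover have "gauss.expectation (\<lambda>x. r * w x - X x) = 0" using int mean0 by simp
    ultimately have "AE x in std_gauss. r * w x - X x = 0"
      using le by (subst integral_nonneg_eq_0_iff_AE[symmetric]) auto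
    then have "gauss.expectation (\<lambda>x. X x * w x) = gauss.expectation (\<lambda>x. r * (w x)\<^sup>2)"
      by (intro integral_cong_AE) (auto simp: power2_eq_square)
    then show ?thesis by (simp add: Ew)
  qed
  \<comment> \<open>Expanding the square and inserting the correlation bound shows that X has at
    least the second moment of r w.\<close>
  have "0 \<le> gauss.expectation (\<lambda>x. (X x - r * w x)\<^sup>2)" by simp
  also have "(\<lambda>x. (X x - r * w x)\<^sup>2) = (\<lambda>x. (X x)\<^sup>2 - 2 * r * (X x * w x) + r\<^sup>2 * (w x)\<^sup>2)"
    by (rule ext) (simp add: algebra_simps power2_eq_square)
  also have "gauss.expectation \<dots> = gauss.expectation (\<lambda>x. (X x)\<^sup>2)
       - 2 * r * gauss.expectation (\<lambda>x. X x * w x) + r\<^sup>2 * pos_part_square s"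
    using int by (subst Bochner_Integration.integral_add, simp, simp)
       (subst Bochner_Integration.integral_diff, simp_all add: Ew)
  finally have *: "2 * r * gauss.expectation (\<lambda>x. X x * w x) \<le> gauss.expectation (\<lambda>x. (X x)\<^sup>2) + r\<^sup>2 * pos_part_square s"
    by simp
  have "r \<ge> 0"
    unfolding r_def using A nonneg by (intro divide_nonneg_pos integral_nonneg_AE) auto
  then have "2 * r * (r * pos_part_square s) \<le> 2 * r * gauss.expectation (\<lambda>x. X x * w x)"
    using key by (intro mult_left_mono) auto
  with * have "r\<^sup>2 * pos_part_square s \<le> gauss.expectation (\<lambda>x. (X x)\<^sup>2)"
    by (simp add: power2_eq_square)
  then have "(pos_part_mean s)\<^sup>2 * (r\<^sup>2 * pos_part_square s) \<le> (pos_part_mean s)\<^sup>2 * gauss.expectation (\<lambda>x. (X x)\<^sup>2)"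
    by (intro mult_left_mono) auto
  then show ?thesis using A by (simp add: r_def power_divide)
qed

lemma convex_on_UNIV_continuous:
  fixes k :: "real \<Rightarrow> real"
  shows "convex_on UNIV k \<Longrightarrow> continuous_on UNIV k"
  by (rule convex_on_continuous) auto

text \<open>If k z < M for some z > 0, then M \<le> k x would hold only beyond z, an event of
  probability below 1/2. Letting z decrease to 0 gives M \<le> k 0, and Jensen applies at the mean
  0.\<close>

lemma gauss_convex_median_le_mean:
  fixes k :: "real \<Rightarrow> real"
  assumes conv: "convex_on UNIV k" and mono: "mono k" and int: "integrable std_gauss k"
    and M: "1 / 2 \<le> gauss.prob {x. M \<le> k x}"
  shows "M \<le> gauss.expectation k"
proof -
  have cont: "continuous_on UNIV k" using conv by (rule convex_on_UNIV_continuous)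
  have "M \<le> k z" if "z > 0" for z
  proof (rule ccontr)
    assume "\<not> M \<le> k z"
    then have "\<not> M \<le> k x" if "x \<le> z" for x
      using monoD[OF mono that] by linarith
    then have "{x. M \<le> k x} \<subseteq> {z<..}" by (auto simp: not_le[symmetric])
    then have "gauss.prob {x. M \<le> k x} \<le> gauss.prob {z<..}"
      by (intro gauss.finite_measure_mono) auto
    also have "\<dots> = \<Phi> (- z)" by (rule gauss_prob_greaterThan)
    also have "\<dots> < \<Phi> 0" using that by simp
    also have "\<Phi> 0 = 1 / 2" using Phi_minus[of 0] by simp
    finally show False using M by simp
  qed
  then have "\<forall>\<^sub>F z in at_right 0. M \<le> k z"
    by (auto simp: eventually_at_right_field intro!: exI[of _ 1])
  moreover have "(k \<longlongrightarrow> k 0) (at_right 0)"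
    using cont by (simp add: continuous_on_eq_continuous_at isCont_def filterlim_at_split)
  ultimately have "M \<le> k 0" by (intro tendsto_lowerbound[where F="at_right 0" and f=k]) auto
  also have "k 0 = k (gauss.expectation (\<lambda>x. x))"
    using integral_std_normal_distribution_moment_odd[of 1] by simp
  also have "\<dots> \<le> gauss.expectation k"
    using gauss.jensens_inequality[where X="\<lambda>x. x" and I=UNIV and q=k]
      integrable_std_normal_distribution_moment[of 1] conv int by simp
  finally show ?thesis .
qed

lemma gauss_convex_lower_tail:
  fixes k :: "real \<Rightarrow> real"
  assumes conv: "convex_on UNIV k" and mono: "mono k" and int2: "integrable std_gauss (\<lambda>x. (k x)\<^sup>2)"
    and var: "0 < gauss.variance k" and t: "0 < t"
  shows "gauss.prob {x. k x \<le> gauss.expectation k - t * sqrt (gauss.variance k)} \<le> exp (- (t\<^sup>2 / 2))"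
proof -
  define m where "m = gauss.expectation k"
  define v where "v = gauss.variance k"
  define d where "d = t * sqrt v"
  define c where "c = m - d"
  have v: "v > 0" using var by (simp add: v_def)
  have d: "d > 0" using v t by (simp add: d_def)
  have cont: "continuous_on UNIV k" using conv by (rule convex_on_UNIV_continuous)
  have [measurable]: "k \<in> borel_measurable borel" using cont by (rule borel_measurable_continuous_onI)
  have int: "integrable std_gauss k" using int2 by (rule gauss_integrable_of_square[rotated]) measurable
  define S where "S = {x. k x \<le> c}"
  have "gauss.prob S \<le> exp (- (t\<^sup>2 / 2))"
  proof (cases "S = {}")
    case False
    \<comment> \<open>Since c is below the mean, k exceeds it somewhere; by monotonicity S is then
      bounded above and its supremum b is a real number.\<close>
    have "\<exists>x. c < k x"
    proof (rule ccontr)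
      assume "\<nexists>x. c < k x"
      then have "gauss.expectation k \<le> c" 
        using int by (intro gauss.integral_le_const) (auto simp: not_less)
      then show False using d by (simp add: c_def m_def)
    qed
    then obtain x1 where x1: "c < k x1" by blast
    have "x \<le> x1" if "x \<in> S" for x
      using that x1 monoD[OF mono, of x1 x] by (auto simp: S_def intro: leI)
    then have bdd: "bdd_above S" by (rule bdd_aboveI)
    define b where "b = Sup S"
    have "closed S" unfolding S_def using cont by (intro closed_Collect_le) auto
    then have "b \<in> S" unfolding b_def using False bdd by (intro closed_contains_Sup)
    then have kb: "k b \<le> c" by (simp add: S_def)
    have Sb: "S \<subseteq> {..b}" unfolding b_def using bdd by (auto intro: cSup_upper)
    define s where "s = - b"
    define X where "X = (\<lambda>x. max (k x - c) 0)"
    have [measurable]: "X \<in> borel_measurable borel" unfolding X_def by measurable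
    have kc2: "integrable std_gauss (\<lambda>x. (k x - c)\<^sup>2)"
      using int int2 by (simp add: power2_diff)
    have X2: "integrable std_gauss (\<lambda>x. (X x)\<^sup>2)"
    proof (rule Bochner_Integration.integrable_bound[OF kc2])
      show "AE x in std_gauss. norm ((X x)\<^sup>2) \<le> norm ((k x - c)\<^sup>2)"
        by (auto simp: X_def max_def)
    qed simp
    have iX: "integrable std_gauss X" using X2 by (rule gauss_integrable_of_square[rotated]) measurable
    have main: "(gauss.expectation X)\<^sup>2 * pos_part_square s
       \<le> (pos_part_mean s)\<^sup>2 * gauss.expectation (\<lambda>x. (X x)\<^sup>2)"
    proof (rule second_moment_ge_ramp)
      show "X x = 0" if "x \<le> - s" for x
        using monoD[OF mono, of x b] that kb by (simp add: X_def s_def)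
      show "X x * (y + s) \<le> X y * (x + s)" if "- s < x" "x < y" for x y
      proof -
        \<comment> \<open>Writing x as a convex combination of b and y, with k b \<le> c, gives the
          monotone ratio X x / (x - b) demanded by the comparison with the ramp.\<close>
        define u where "u = (x - b) / (y - b)"
        have u: "0 \<le> u" "u \<le> 1" "u * (y - b) = x - b" using that by (auto simp: u_def s_def)
        have "k x = k ((1 - u) * b + u * y)" using u(3) by (simp add: algebra_simps)
        also have "\<dots> \<le> (1 - u) * k b + u * k y"
          using convex_onD[OF conv, of u b y] u by simp
        finally have "k x - c \<le> (1 - u) * (k b - c) + u * (k y - c)" by (simp add: algebra_simps)
        also have "\<dots> \<le> 0 + u * X y"
          using u kb by (intro add_mono mult_nonneg_nonpos mult_left_mono) (auto simp: X_def)
        finally have "X x \<le> u * X y" using u by (simp add: X_def)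
        then have "X x * (y - b) \<le> u * X y * (y - b)"
          using that by (intro mult_right_mono) (auto simp: s_def)
        also have "\<dots> = X y * (x - b)" using u(3) by (simp add: mult_ac)
        finally show ?thesis by (simp add: s_def)
      qed
    qed (use X2 in \<open>auto simp: X_def\<close>)
    define VX where "VX = gauss.expectation (\<lambda>x. (X x)\<^sup>2) - (gauss.expectation X)\<^sup>2"
    define VW where "VW = pos_part_square s - (pos_part_mean s)\<^sup>2"
    have VW: "VW > 0" using pos_part_variance_pos[of s] by (simp add: VW_def)
    have VX: "VX \<ge> 0"
      using gauss.variance_eq[OF iX X2] gauss.variance_positive[of X] by (simp add: VX_def)
    define \<kappa> where "\<kappa> = - 2 * ln (\<Phi> b)"
    have \<kappa>: "\<kappa> \<ge> 0" unfolding \<kappa>_def using ln_le_zero_iff[of "\<Phi> b"] by simp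
    have "(gauss.expectation X)\<^sup>2 * VW \<le> (pos_part_mean s)\<^sup>2 * VX"
      using main by (simp add: VW_def VX_def algebra_simps)
    also have "\<dots> \<le> \<kappa> * VW * VX"
      using pos_part_mean_square_le[of s] VX by (intro mult_right_mono) (auto simp: VW_def \<kappa>_def s_def)
    finally have "(gauss.expectation X)\<^sup>2 * VW \<le> \<kappa> * VX * VW" by (simp add: mult_ac)
    then have 1: "(gauss.expectation X)\<^sup>2 \<le> \<kappa> * VX" using VW by simp
    \<comment> \<open>As c = m - d, X - d is k - m truncated below at -d, hence smaller in absolute
      value; and a second moment about any point, here d, is at least the variance.\<close>
    have 2: "VX \<le> v"
    proof -
      have "VX \<le> gauss.expectation (\<lambda>x. (X x)\<^sup>2) - (gauss.expectation X)\<^sup>2 + (gauss.expectation X - d)\<^sup>2"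
        by (simp add: VX_def)
      also have "\<dots> = gauss.expectation (\<lambda>x. (X x)\<^sup>2 - 2 * d * X x + d\<^sup>2)"
        using iX X2 gauss.prob_space by (simp add: power2_diff)
      also have "\<dots> \<le> gauss.expectation (\<lambda>x. (k x - m)\<^sup>2)"
      proof (rule integral_mono)
        show "integrable std_gauss (\<lambda>x. (X x)\<^sup>2 - 2 * d * X x + d\<^sup>2)" using iX X2 by simp
        show "integrable std_gauss (\<lambda>x. (k x - m)\<^sup>2)" using int int2 by (simp add: power2_diff)
        fix x
        have "\<bar>X x - d\<bar> \<le> \<bar>k x - m\<bar>" using d by (auto simp: X_def c_def max_def)
        then have "(X x - d)\<^sup>2 \<le> (k x - m)\<^sup>2" by (simp add: abs_le_square_iff)
        then show "(X x)\<^sup>2 - 2 * d * X x + d\<^sup>2 \<le> (k x - m)\<^sup>2"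
          by (simp add: power2_diff[of "X x"] mult_ac)
      qed
      finally show ?thesis by (simp add: v_def m_def)
    qed
    \<comment> \<open>Truncation from below raises the mean, so \<open>gauss.expectation X\<close>
      is at least d; with the ramp inequality, d^2 = t^2 v \<le> \<kappa> v.\<close>
    have "m - c \<le> gauss.expectation X"
    proof -
      have "gauss.expectation (\<lambda>x. k x - c) \<le> gauss.expectation X"
        by (rule integral_mono) (use int iX in \<open>auto simp: X_def\<close>)
      then show ?thesis using int gauss.prob_space by (simp add: m_def)
    qed
    then have "d\<^sup>2 \<le> (gauss.expectation X)\<^sup>2" using d by (intro power_mono) (auto simp: c_def)
    also have "\<dots> \<le> \<kappa> * v" using 1 mult_left_mono[OF 2 \<kappa>] by linarith
    finally have "t\<^sup>2 * v \<le> \<kappa> * v" using v by (simp add: d_def power_mult_distrib)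
    then have "t\<^sup>2 \<le> \<kappa>" using v by simp
    then have "ln (\<Phi> b) \<le> - (t\<^sup>2 / 2)" by (simp add: \<kappa>_def)
    then have "exp (ln (\<Phi> b)) \<le> exp (- (t\<^sup>2 / 2))" by (simp only: exp_le_cancel_iff)
    then have "\<Phi> b \<le> exp (- (t\<^sup>2 / 2))" by simp
    moreover have "gauss.prob S \<le> gauss.prob {..b}" using Sb by (intro gauss.finite_measure_mono) auto
    ultimately show ?thesis by (simp add: gauss_prob_atMost)
  qed simp
  then show ?thesis by (simp add: S_def c_def d_def m_def v_def)
qed

subsection \<open>Ehrhard's inequality in product spaces\<close>

abbreviation gauss_PiM :: "'i set \<Rightarrow> ('i \<Rightarrow> real) measure" where
  "gauss_PiM I \<equiv> PiM I (\<lambda>_. std_gauss)"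


lemma prob_space_gauss_PiM: "prob_space (gauss_PiM I)"
  by (rule prob_space_PiM) (rule gauss.prob_space_axioms)

text \<open>I may be a proper part of the index type, as the induction on I requires. Coordinates
  outside I are constantly \<open>undefined\<close> on the product space and therefore
  measurable.\<close>

lemma measurable_gauss_PiM_borel:
  fixes I :: "'i::countable set"
  shows "(\<lambda>x. x) \<in> borel_measurable (gauss_PiM I)"
proof -
  have "(\<lambda>x. x) \<in> measurable (gauss_PiM I) (PiM UNIV (\<lambda>_. borel))"
  proof (rule measurable_PiM_single')
    fix i :: 'i
    show "(\<lambda>x. x i) \<in> borel_measurable (gauss_PiM I)"
    proof (cases "i \<in> I")
      case True
      have "(\<lambda>x. x i) \<in> measurable (gauss_PiM I) std_gauss"
        using True by (rule measurable_component_singleton)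
      then show ?thesis by simp
    next
      case False
      have "(\<lambda>x. x i) \<in> borel_measurable (gauss_PiM I) \<longleftrightarrow> (\<lambda>x. undefined :: real) \<in> borel_measurable (gauss_PiM I)"
        by (rule measurable_cong) (simp add: space_PiM PiE_arb[OF _ False])
      then show ?thesis by simp
    qed
  qed (simp add: PiE_def)
  then show ?thesis
    by (subst measurable_cong_sets[OF refl sets_PiM_equal_borel[symmetric]])
qed

lemma measurable_continuous_gauss_PiM:
  fixes f :: "('i::countable \<Rightarrow> real) \<Rightarrow> real"
  assumes "continuous_on UNIV f"
  shows "f \<in> borel_measurable (gauss_PiM I)"
  by (rule measurable_compose[OF measurable_gauss_PiM_borel borel_measurable_continuous_onI[OF assms]])

lemma continuous_on_fun_upd:
  "continuous_on UNIV (\<lambda>x::'i \<Rightarrow> real. x(i := z))"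
proof (rule continuous_on_coordinatewise_then_product)
  fix j show "continuous_on UNIV (\<lambda>x::'i \<Rightarrow> real. (x(i := z)) j)"
    by (cases "j = i") simp_all
qed

lemma continuous_on_fun_upd2:
  "continuous_on UNIV (\<lambda>z::real. x(i := z))"
proof (rule continuous_on_coordinatewise_then_product)
  fix j show "continuous_on UNIV (\<lambda>z. (x(i := z)) j)"
    by (cases "j = i") simp_all
qed

text \<open>Induction on I. Integrating out coordinate i and applying \<open>probit\<close>
  preserves continuity and the bound L, and the one-dimensional theorem in that coordinate preserves
  the three-function hypothesis. The functions live on all of \<open>'i \<Rightarrow> real\<close>,
  so the hypothesis keeps its form while I shrinks.\<close>

theorem ehrhard_functional_PiM:
  fixes u0 u1 um :: "('i::countable \<Rightarrow> real) \<Rightarrow> real"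
  assumes "finite I"
    and "continuous_on UNIV u0" "continuous_on UNIV u1" "continuous_on UNIV um"
    and "\<And>x. \<bar>u0 x\<bar> \<le> L" "\<And>x. \<bar>u1 x\<bar> \<le> L" "\<And>x. \<bar>um x\<bar> \<le> L"
    and l: "0 < l" "l < 1"
    and "\<And>x y. (1 - l) * u0 x + l * u1 y \<le> um (\<lambda>i. (1 - l) * x i + l * y i)"
  shows "(1 - l) * probit (\<integral>x. \<Phi> (u0 x) \<partial>gauss_PiM I) + l * probit (\<integral>x. \<Phi> (u1 x) \<partial>gauss_PiM I)
     \<le> probit (\<integral>x. \<Phi> (um x) \<partial>gauss_PiM I)"
  using assms(1-7,10)
proof (induction I arbitrary: u0 u1 um)
  case empty
  \<comment> \<open>The empty product is the point mass at \<open>\<lambda>_. undefined\<close>, and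
    \<open>undefined\<close> is one fixed real number, so this point combined with itself is
    itself.\<close>
  have "(1 - l) * u0 (\<lambda>_. undefined) + l * u1 (\<lambda>_. undefined) \<le> um (\<lambda>_. (1 - l) * undefined + l * undefined)"
    by (rule empty.prems(7))
  also have "(\<lambda>_::'i. (1 - l) * undefined + l * undefined) = (\<lambda>_. undefined :: real)"
    by (simp add: algebra_simps)
  finally show ?case by (simp add: PiM_empty lebesgue_integral_count_space_finite)
next
  case (insert i I)
  interpret gauss_product: product_sigma_finite "\<lambda>_ :: 'i. std_gauss" ..
  define S where "S = (\<lambda>u x. probit (gauss.expectation (\<lambda>z. \<Phi> (u (x(i := z))))))"
  have rng: "\<Phi> (- L) \<le> gauss.expectation (\<lambda>z. \<Phi> (u (x(i := z))))" 
      "gauss.expectation (\<lambda>z. \<Phi> (u (x(i := z)))) \<le> \<Phi> L"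
      "integrable std_gauss (\<lambda>z. \<Phi> (u (x(i := z))))"
    if u: "continuous_on UNIV u" "\<And>x. \<bar>u x\<bar> \<le> L" for u :: "('i \<Rightarrow> real) \<Rightarrow> real" and x
  proof -
    have "- L \<le> u y" "u y \<le> L" for y using u(2)[of y] by linarith+
    moreover show "integrable std_gauss (\<lambda>z. \<Phi> (u (x(i := z))))"
      by (intro gauss_integrable_bounded[where B=1] borel_measurable_continuous_onI continuous_intros
         continuous_on_compose2[OF u(1) continuous_on_fun_upd2]) auto
    ultimately show "\<Phi> (- L) \<le> gauss.expectation (\<lambda>z. \<Phi> (u (x(i := z))))" 
      "gauss.expectation (\<lambda>z. \<Phi> (u (x(i := z)))) \<le> \<Phi> L"
      by (auto intro!: gauss.integral_ge_const gauss.integral_le_const AE_I2)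
  qed
  have Sb: "\<bar>S u x\<bar> \<le> L" if u: "continuous_on UNIV u" "\<And>x. \<bar>u x\<bar> \<le> L" for u x
    unfolding S_def using probit_bounds(3,4)[OF rng(1,2)[OF u], of x] by linarith
  have Sc: "continuous_on UNIV (S u)" if u: "continuous_on UNIV u" "\<And>x. \<bar>u x\<bar> \<le> L" for u
  proof -
    have "isCont (S u) x" for x
      unfolding isCont_def tendsto_at_iff_sequentially comp_def
    proof (intro allI impI)
      fix X :: "nat \<Rightarrow> 'i \<Rightarrow> real" assume X: "X \<longlonglongrightarrow> x"
      have "(\<lambda>n. gauss.expectation (\<lambda>z. \<Phi> (u ((X n)(i := z))))) \<longlonglongrightarrow> gauss.expectation (\<lambda>z. \<Phi> (u (x(i := z))))"
      proof (rule integral_dominated_convergence[where w="\<lambda>_. 1"])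
        show "AE z in std_gauss. (\<lambda>n. \<Phi> (u ((X n)(i := z)))) \<longlonglongrightarrow> \<Phi> (u (x(i := z)))"
        proof (rule AE_I2)
          fix z
          have "isCont (\<lambda>x. \<Phi> (u (x(i := z)))) x"
            using continuous_on_Phi[OF continuous_on_compose2[OF u(1) continuous_on_fun_upd]]
            by (auto simp: continuous_on_eq_continuous_at)
          then show "(\<lambda>n. \<Phi> (u ((X n)(i := z)))) \<longlonglongrightarrow> \<Phi> (u (x(i := z)))"
            using X by (rule isCont_tendsto_compose)
        qed
      qed (use rng(3)[OF u] in \<open>auto dest: borel_measurable_integrable\<close>)
      then show "(\<lambda>n. S u (X n)) \<longlonglongrightarrow> S u x"
        unfolding S_def using probit_bounds(1,2)[OF rng(1,2)[OF u]] by (intro tendsto_probit) auto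
    qed
    then show ?thesis by (simp add: continuous_at_imp_continuous_on)
  qed
  have eq: "(\<integral>x. \<Phi> (u x) \<partial>gauss_PiM (insert i I)) = (\<integral>x. \<Phi> (S u x) \<partial>gauss_PiM I)"
    if u: "continuous_on UNIV u" "\<And>x. \<bar>u x\<bar> \<le> L" for u
  proof -
    interpret P: prob_space "gauss_PiM (insert i I)" by (rule prob_space_gauss_PiM)
    have "integrable (gauss_PiM (insert i I)) (\<lambda>x. \<Phi> (u x))"
      by (rule P.integrable_const_bound[where B=1])
         (auto intro!: measurable_continuous_gauss_PiM continuous_intros u(1))
    then have "(\<integral>x. \<Phi> (u x) \<partial>gauss_PiM (insert i I)) = (\<integral>x. gauss.expectation (\<lambda>z. \<Phi> (u (x(i := z)))) \<partial>gauss_PiM I)"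
      by (rule gauss_product.product_integral_insert[OF insert.hyps])
    also have "\<dots> = (\<integral>x. \<Phi> (S u x) \<partial>gauss_PiM I)"
      unfolding S_def using Phi_probit[OF probit_bounds(1,2)[OF rng(1,2)[OF u]]] by simp
    finally show ?thesis .
  qed
  have "(1 - l) * S u0 x + l * S u1 y \<le> S um (\<lambda>j. (1 - l) * x j + l * y j)" for x y
    unfolding S_def
  proof (rule ehrhard_functional_real[OF _ _ _ _ _ _ l])
    fix s t
    have "(1 - l) * u0 (x(i := s)) + l * u1 (y(i := t)) \<le> um (\<lambda>j. (1 - l) * (x(i := s)) j + l * (y(i := t)) j)"
      by (rule insert.prems)
    also have "(\<lambda>j. (1 - l) * (x(i := s)) j + l * (y(i := t)) j) = (\<lambda>j. (1 - l) * x j + l * y j)(i := (1 - l) * s + l * t)"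
      by auto
    finally show "(1 - l) * u0 (x(i := s)) + l * u1 (y(i := t)) \<le> um ((\<lambda>j. (1 - l) * x j + l * y j)(i := (1 - l) * s + l * t))" .
  qed (use insert.prems in \<open>auto intro: continuous_on_compose2[OF _ continuous_on_fun_upd2]\<close>)
  then show ?case
    using insert.prems Sc Sb by (simp add: eq insert.IH)
qed

section \<open>From functions to sublevel sets and to the rearrangement\<close>

text \<open>Concavity of \<open>probit\<close> composed with D, phrased through \<Phi> because D may
  take the values 0 and 1, where \<open>probit\<close> carries no information.\<close>

lemma ehrhard_convex_cdf:
  fixes F :: "('i::countable \<Rightarrow> real) \<Rightarrow> real"
  assumes I: "finite I" and F: "continuous_on UNIV F" and l: "0 < l" "l < 1"
    and conv: "\<And>x y. F (\<lambda>i. (1 - l) * x i + l * y i) \<le> (1 - l) * F x + l * F y"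
  defines "D \<equiv> cdf (distr (gauss_PiM I) borel F)"
  assumes z: "\<Phi> z0 \<le> D \<tau>0" "\<Phi> z1 \<le> D \<tau>1"
  shows "\<Phi> ((1 - l) * z0 + l * z1) \<le> D ((1 - l) * \<tau>0 + l * \<tau>1)"
proof -
  interpret P: prob_space "gauss_PiM I" by (rule prob_space_gauss_PiM)
  have F_meas [measurable]: "F \<in> borel_measurable (gauss_PiM I)"
    using F by (rule measurable_continuous_gauss_PiM)
  interpret N: real_distribution "distr (gauss_PiM I) borel F"
    by (rule P.real_distribution_distr) measurable
  define \<tau> where "\<tau> = (1 - l) * \<tau>0 + l * \<tau>1"
  have D: "D t = P.expectation (\<lambda>x. indicator {..t} (F x))" for t
  proof -
    have "D t = N.expectation (indicator {..t})" by (simp add: D_def cdf_def)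
    also have "\<dots> = P.expectation (\<lambda>x. indicator {..t} (F x))" by (rule integral_distr) measurable
    finally show ?thesis .
  qed
  have ind: "integrable (gauss_PiM I) (\<lambda>x. indicator {..t} (F x) :: real)" for t
    by (rule P.integrable_const_bound[where B=1]) auto
  \<comment> \<open>The factors \<open>\<Phi> (real n)\<close> and the term
    \<open>\<Phi> (- real n)\<close> are the cost of cutting at height n instead of infinity. The
    slope n^2 takes the cut-off from n down to -n over a layer of width 2/n, which must fit into
    \<delta>.\<close>
  have main: "\<Phi> ((1 - l) * probit (\<Phi> (real n) * \<Phi> z0) + l * probit (\<Phi> (real n) * \<Phi> z1)) \<le> D (\<tau> + \<delta>) + \<Phi> (- real n)"
    if n: "real n * \<delta> \<ge> 2" and "\<delta> > 0" for n :: nat and \<delta>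
  proof -
    define b where "b = real n"
    have b: "b > 0" "b * \<delta> \<ge> 2" using n \<open>\<delta> > 0\<close> by (auto simp: b_def intro!: gr0I)
    \<comment> \<open>Makes both (1 - l) L and l L at least 2 b, so a combination with one term at
      -L and the other at most b is at most -2 b + b = -b.\<close>
    define L where "L = 2 * b / (l * (1 - l))"
    have L1: "(1 - l) * L = 2 * b / l" and L2: "l * L = 2 * b / (1 - l)"
      using l by (simp_all add: L_def)
    have "2 * b * 1 \<le> 2 * b / l" "2 * b * 1 \<le> 2 * b / (1 - l)"
      using l b by (auto simp: field_simps)
    with L1 L2 have L: "2 * b \<le> (1 - l) * L" "2 * b \<le> l * L" by simp_all
    then have Lb: "4 * b \<le> L" by (simp add: algebra_simps)
    \<comment> \<open>\<open>u t\<close> approximates \<open>\<infinity>\<close> on \<open>{F \<le> t}\<close> and \<open>-\<infinity>\<close> off it. With \<open>L\<close> so much larger than \<open>b\<close>,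
      a combination in which one term is \<open>-L\<close> stays below \<open>-b\<close>, so \<open>um\<close> may be cut at \<open>-b\<close>.\<close>
    define c where "c = (\<lambda>t x. b + b\<^sup>2 * (t - F x))"
    define u where "u = (\<lambda>t x. max (min (c t x) b) (- L))"
    define um where "um = (\<lambda>x. max (min (c \<tau> x) b) (- b))"
    have cu: "continuous_on UNIV (u t)" for t unfolding u_def c_def by (intro continuous_intros F)
    have cum: "continuous_on UNIV um" unfolding um_def c_def by (intro continuous_intros F)
    have bu: "- L \<le> u t x" "u t x \<le> b" "\<bar>u t x\<bar> \<le> L" for t x
      using Lb b unfolding u_def by (auto simp: abs_le_iff)
    have bum: "- b \<le> um x" "um x \<le> b" "\<bar>um x\<bar> \<le> L" for x
      using Lb b unfolding um_def by (auto simp: abs_le_iff)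
    have intPhi: "integrable (gauss_PiM I) (\<lambda>x. \<Phi> (v x))" if "continuous_on UNIV v" for v
      by (rule P.integrable_const_bound[where B=1])
         (auto intro!: measurable_continuous_gauss_PiM continuous_intros that)
    have comb: "(1 - l) * u \<tau>0 x + l * u \<tau>1 y \<le> um (\<lambda>i. (1 - l) * x i + l * y i)" for x y
    proof -
      let ?m = "\<lambda>i. (1 - l) * x i + l * y i"
      consider "c \<tau>0 x < - L" | "c \<tau>1 y < - L" | "c \<tau>0 x \<ge> - L" "c \<tau>1 y \<ge> - L" by linarith
      then show ?thesis
      proof cases
        case 1
        then have "u \<tau>0 x = - L" by (simp add: u_def)
        moreover have "l * u \<tau>1 y \<le> l * b" "l * b \<le> 1 * b"
          using bu(2) b l by (intro mult_left_mono mult_right_mono; simp)+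
        ultimately show ?thesis using L(1) bum(1)[of ?m] by (simp del: mult_le_cancel_right1)
      next
        case 2
        then have "u \<tau>1 y = - L" by (simp add: u_def)
        moreover have "(1 - l) * u \<tau>0 x \<le> (1 - l) * b" "(1 - l) * b \<le> 1 * b"
          using bu(2) b l by (intro mult_left_mono mult_right_mono; simp)+
        ultimately show ?thesis using L(2) bum(1)[of ?m] by simp
      next
        case 3
        have "(1 - l) * c \<tau>0 x + l * c \<tau>1 y = b + b\<^sup>2 * (\<tau> - ((1 - l) * F x + l * F y))"
          by (simp add: c_def \<tau>_def algebra_simps)
        also have "\<dots> \<le> c \<tau> ?m"
          unfolding c_def using conv[of x y] by (intro add_left_mono mult_left_mono) auto
        finally have *: "(1 - l) * c \<tau>0 x + l * c \<tau>1 y \<le> c \<tau> ?m" .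
        have uc: "u \<tau>0 x \<le> c \<tau>0 x" "u \<tau>1 y \<le> c \<tau>1 y" using 3 by (simp_all add: u_def)
        have "(1 - l) * u \<tau>0 x + l * u \<tau>1 y \<le> (1 - l) * c \<tau>0 x + l * c \<tau>1 y"
          using l uc by (intro add_mono mult_left_mono) auto
        moreover have "(1 - l) * u \<tau>0 x + l * u \<tau>1 y \<le> (1 - l) * b + l * b"
          using l bu(2) by (intro add_mono mult_left_mono) auto
        ultimately show ?thesis using * unfolding um_def by (simp add: algebra_simps)
      qed
    qed
    have E0: "\<Phi> b * \<Phi> z \<le> P.expectation (\<lambda>x. \<Phi> (u t x))" if "\<Phi> z \<le> D t" for z t
    proof -
      have "\<Phi> b * \<Phi> z \<le> \<Phi> b * D t" using that by (intro mult_left_mono) auto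
      also have "\<dots> = P.expectation (\<lambda>x. \<Phi> b * indicator {..t} (F x))" by (simp add: D)
      also have "\<dots> \<le> P.expectation (\<lambda>x. \<Phi> (u t x))"
      proof (rule integral_mono)
        fix x
        show "\<Phi> b * indicator {..t} (F x) \<le> \<Phi> (u t x)"
        proof (cases "F x \<le> t")
          case True
          then have "b \<le> c t x" by (simp add: c_def)
          then show ?thesis using True Lb b by (simp add: u_def)
        qed simp
      qed (use ind cu in \<open>auto intro: intPhi\<close>)
      finally show ?thesis .
    qed
    have Em: "P.expectation (\<lambda>x. \<Phi> (um x)) \<le> D (\<tau> + \<delta>) + \<Phi> (- b)"
    proof -
      have "P.expectation (\<lambda>x. \<Phi> (um x)) \<le> P.expectation (\<lambda>x. indicator {..\<tau> + \<delta>} (F x) + \<Phi> (- b))"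
      proof (rule integral_mono)
        fix x
        show "\<Phi> (um x) \<le> indicator {..\<tau> + \<delta>} (F x) + \<Phi> (- b)"
        proof (cases "F x \<le> \<tau> + \<delta>")
          case False
          then have "b\<^sup>2 * (\<tau> - F x) \<le> b\<^sup>2 * - \<delta>" by (intro mult_left_mono) auto
          also have "\<dots> = b * - (b * \<delta>)" by (simp add: power2_eq_square)
          also have "\<dots> \<le> b * - 2" using b by (intro mult_left_mono) auto
          finally have "c \<tau> x \<le> - b" by (simp add: c_def)
          then show ?thesis using False by (simp add: um_def)
        qed (simp add: add_increasing2)
      qed (use ind cum in \<open>auto intro: intPhi\<close>)
      also have "\<dots> = D (\<tau> + \<delta>) + \<Phi> (- b)" using ind P.prob_space by (simp add: D)
      finally show ?thesis .
    qed
    have rng: "0 < P.expectation (\<lambda>x. \<Phi> (v x))" "P.expectation (\<lambda>x. \<Phi> (v x)) < 1"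
      if "continuous_on UNIV v" "\<And>x. - L \<le> v x" "\<And>x. v x \<le> b" for v
    proof -
      have "\<Phi> (- L) \<le> P.expectation (\<lambda>x. \<Phi> (v x))" "P.expectation (\<lambda>x. \<Phi> (v x)) \<le> \<Phi> b"
        using that intPhi[OF that(1)] by (auto intro!: P.integral_ge_const P.integral_le_const AE_I2)
      then show "0 < P.expectation (\<lambda>x. \<Phi> (v x))" "P.expectation (\<lambda>x. \<Phi> (v x)) < 1"
        by (rule probit_bounds)+
    qed
    have prb: "probit (\<Phi> b * \<Phi> z) \<le> probit (P.expectation (\<lambda>x. \<Phi> (u t x)))" if "\<Phi> z \<le> D t" for z t
    proof (subst probit_le_iff)
      show "\<Phi> b * \<Phi> z < 1" using mult_strict_mono'[of "\<Phi> b" 1 "\<Phi> z" 1] by simp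
    qed (use E0[OF that] rng[OF cu bu(1,2)] in auto)
    have "(1 - l) * probit (\<Phi> b * \<Phi> z0) + l * probit (\<Phi> b * \<Phi> z1)
      \<le> (1 - l) * probit (P.expectation (\<lambda>x. \<Phi> (u \<tau>0 x))) + l * probit (P.expectation (\<lambda>x. \<Phi> (u \<tau>1 x)))"
      using prb[OF z(1)] prb[OF z(2)] l by (intro add_mono mult_left_mono) auto
    also have "\<dots> \<le> probit (P.expectation (\<lambda>x. \<Phi> (um x)))"
      by (rule ehrhard_functional_PiM[OF I cu cu cum bu(3) bu(3) bum(3) l comb])
    finally have "\<Phi> ((1 - l) * probit (\<Phi> b * \<Phi> z0) + l * probit (\<Phi> b * \<Phi> z1))
      \<le> \<Phi> (probit (P.expectation (\<lambda>x. \<Phi> (um x))))" by simp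
    also have "\<dots> = P.expectation (\<lambda>x. \<Phi> (um x))"
    proof (rule Phi_probit)
      have "- L \<le> um x" for x using bum(3)[of x] by (simp add: abs_le_iff)
      then show "0 < P.expectation (\<lambda>x. \<Phi> (um x))" "P.expectation (\<lambda>x. \<Phi> (um x)) < 1"
        using rng[OF cum] bum(2) by blast+
    qed
    finally show ?thesis using Em unfolding b_def by linarith
  qed
  \<comment> \<open>The height n goes to infinity with \<delta> fixed; \<delta> is then removed by
    right-continuity of D.\<close>
  have "\<Phi> ((1 - l) * z0 + l * z1) \<le> D (\<tau> + \<delta>)" if "\<delta> > 0" for \<delta>
  proof -
    have Phin: "(\<lambda>n. \<Phi> (real n)) \<longlonglongrightarrow> 1"
      by (rule filterlim_compose[OF Phi_tendsto_at_top filterlim_real_sequentially])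
    have Phin': "(\<lambda>n. \<Phi> (- real n)) \<longlonglongrightarrow> 0"
      unfolding Phi_minus using tendsto_diff[OF tendsto_const Phin, of 1] by simp
    have pr: "(\<lambda>n. probit (\<Phi> (real n) * \<Phi> z)) \<longlonglongrightarrow> probit (1 * \<Phi> z)" for z
      by (intro tendsto_probit tendsto_intros Phin) auto
    have "(\<lambda>n. \<Phi> ((1 - l) * probit (\<Phi> (real n) * \<Phi> z0) + l * probit (\<Phi> (real n) * \<Phi> z1)))
       \<longlonglongrightarrow> \<Phi> ((1 - l) * probit (1 * \<Phi> z0) + l * probit (1 * \<Phi> z1))"
      by (intro isCont_tendsto_compose[OF isCont_Phi] tendsto_intros pr)
    moreover have "(\<lambda>n. D (\<tau> + \<delta>) + \<Phi> (- real n)) \<longlonglongrightarrow> D (\<tau> + \<delta>) + 0"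
      by (intro tendsto_intros Phin')
    moreover have "\<forall>\<^sub>F n in sequentially. \<Phi> ((1 - l) * probit (\<Phi> (real n) * \<Phi> z0) + l * probit (\<Phi> (real n) * \<Phi> z1)) \<le> D (\<tau> + \<delta>) + \<Phi> (- real n)"
    proof -
      have "\<forall>\<^sub>F n in sequentially. 2 / \<delta> \<le> real n"
        using filterlim_real_sequentially by (simp add: filterlim_at_top)
      then show ?thesis
        by eventually_elim (rule main, use that in \<open>simp_all add: pos_divide_le_eq\<close>)
    qed
    ultimately show ?thesis
      using tendsto_le[OF trivial_limit_sequentially] by fastforce
  qed
  then have "\<Phi> ((1 - l) * z0 + l * z1) \<le> D x" if "\<tau> < x" for x
    using that by (metis add_diff_cancel_left' add_diff_eq diff_gt_0_iff_gt)
  then have "\<forall>\<^sub>F x in at_right \<tau>. \<Phi> ((1 - l) * z0 + l * z1) \<le> D x"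
    by (rule eventually_mono[OF eventually_at_right_less])
  moreover have "(D \<longlongrightarrow> D \<tau>) (at_right \<tau>)"
    using N.cdf_is_right_cont[of \<tau>] by (simp add: D_def continuous_within)
  ultimately show ?thesis
    unfolding \<tau>_def by (intro tendsto_lowerbound[where f=D and F="at_right \<tau>"]) (auto simp: \<tau>_def)
qed

text \<open>The quantile function of N composed with \<Phi>. Everything follows from the Galois
  connection k z \<le> x iff \<Phi> z \<le> cdf N x: \<open>conc\<close> is convexity of k read
  through it, and the law of k comes from \<Phi> being the Gaussian distribution function.\<close>

lemma gauss_rearrangement:
  fixes N :: "real measure"
  assumes "real_distribution N"
    and conc: "\<And>l z0 z1 \<tau>0 \<tau>1. 0 < l \<Longrightarrow> l < 1 \<Longrightarrow> \<Phi> z0 \<le> cdf N \<tau>0 \<Longrightarrow> \<Phi> z1 \<le> cdf N \<tau>1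
      \<Longrightarrow> \<Phi> ((1 - l) * z0 + l * z1) \<le> cdf N ((1 - l) * \<tau>0 + l * \<tau>1)"
  obtains k where "convex_on UNIV k" "mono k" "distr std_gauss borel k = N"
proof -
  interpret N: cdf_distribution N using assms(1) by (simp add: cdf_distribution_def)
  define k where "k = (\<lambda>z. N.I (\<Phi> z))"
  have k: "k z \<le> x \<longleftrightarrow> \<Phi> z \<le> cdf N x" for z x
    unfolding k_def using N.pseudoinverse[of "\<Phi> z" x] by simp
  have k': "\<Phi> z \<le> cdf N (k z)" for z using k[of z "k z"] by simp
  have "convex_on UNIV k"
  proof (rule convex_onI)
    fix t x y :: real assume t: "0 < t" "t < 1"
    have "\<Phi> ((1 - t) * x + t * y) \<le> cdf N ((1 - t) * k x + t * k y)"
      using t k' by (intro conc)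
    then show "k ((1 - t) *\<^sub>R x + t *\<^sub>R y) \<le> (1 - t) * k x + t * k y" by (simp add: k)
  qed simp
  moreover have mono: "mono k"
  proof (rule monoI)
    fix x y :: real assume "x \<le> y"
    then have "\<Phi> x \<le> cdf N (k y)" using k'[of y] by (meson Phi_le_iff order_trans)
    then show "k x \<le> k y" by (simp add: k)
  qed
  moreover have "distr std_gauss borel k = N"
  proof (rule cdf_unique)
    have m: "k \<in> borel_measurable borel" using mono by (rule borel_measurable_mono)
    show "real_distribution (distr std_gauss borel k)"
      using m by (intro gauss.real_distribution_distr) simp
    show "cdf (distr std_gauss borel k) = cdf N"
    proof
      fix x
      have "cdf (distr std_gauss borel k) x = gauss.prob (k -` {..x} \<inter> space std_gauss)"
        unfolding cdf_def using m by (intro measure_distr) auto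
      also have "k -` {..x} \<inter> space std_gauss = {z. \<Phi> z \<le> cdf N x}" by (auto simp: k)
      also have "gauss.prob {z. \<Phi> z \<le> cdf N x} = cdf N x"
      proof -
        \<comment> \<open>At the values 0 and 1 the sublevel set is empty or the whole line, and
          \<open>probit\<close> does not describe it.\<close>
        consider "cdf N x = 0" | "cdf N x = 1" | "0 < cdf N x" "cdf N x < 1"
          using N.cdf_nonneg[of x] N.cdf_bounded_prob[of x] by linarith
        then show ?thesis
        proof cases
          case 1
          then have "{z. \<Phi> z \<le> cdf N x} = {}" by (auto simp: not_le)
          then show ?thesis using 1 by simp
        next
          case 2
          then have "{z. \<Phi> z \<le> cdf N x} = space std_gauss" by auto
          then show ?thesis using 2 gauss.prob_space by simp
        next
          case 3
          then have "{z. \<Phi> z \<le> cdf N x} = {..probit (cdf N x)}"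
            using Phi_probit[OF 3] by (metis (no_types, lifting) Phi_le_iff Collect_cong atMost_def)
          then show ?thesis using Phi_probit[OF 3] by (simp add: \<Phi>_def cdf_def)
        qed
      qed
      finally show "cdf (distr std_gauss borel k) x = cdf N x" .
    qed
  qed fact
  ultimately show ?thesis by (rule that)
qed

subsection \<open>Convex functions of a Gaussian vector\<close>

lemma gauss_open_pos:
  assumes "open A" "A \<noteq> {}"
  shows "0 < gauss.prob A"
proof -
  obtain x where x: "x \<in> A" using assms by blast
  then obtain e where e: "e > 0" "ball x e \<subseteq> A" using assms(1) by (auto simp: open_contains_ball)
  have "0 < \<Phi> (x + e / 2) - \<Phi> x" using e by simp
  also have "\<dots> = gauss.prob {x<..x + e / 2}"
    unfolding \<Phi>_def using e by (intro gauss.cdf_diff_eq) simp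
  also have "\<dots> \<le> gauss.prob A"
    using e assms(1) by (intro gauss.finite_measure_mono) (auto simp: dist_real_def subset_iff)
  finally show ?thesis .
qed

text \<open>A nonempty open set contains a product of nonempty open sets, whose measure is a product
  of positive factors.\<close>

lemma gauss_PiM_open_pos:
  fixes A :: "('i::finite \<Rightarrow> real) set"
  assumes A: "open A" "A \<noteq> {}"
  shows "0 < measure (gauss_PiM UNIV) A"
proof -
  interpret product_sigma_finite "\<lambda>_ :: 'i. std_gauss" ..
  interpret P: prob_space "gauss_PiM (UNIV :: 'i set)" by (rule prob_space_gauss_PiM)
  have sets: "sets (gauss_PiM UNIV) = sets (borel :: ('i \<Rightarrow> real) measure)"
    unfolding sets_PiM_equal_borel[symmetric] by (rule sets_PiM_cong) simp_all
  obtain x where "x \<in> A" using A(2) by blast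
  then obtain X where X: "x \<in> Pi\<^sub>E UNIV X" "\<And>i. open (X i)" "Pi\<^sub>E UNIV X \<subseteq> A"
    using product_topology_open_contains_basis[of "\<lambda>_. euclidean" UNIV A x] A(1)
    by (auto simp: euclidean_product_topology)
  have "emeasure (gauss_PiM UNIV) (Pi\<^sub>E UNIV X) = (\<Prod>i\<in>UNIV. emeasure std_gauss (X i))"
    using X(2) by (intro emeasure_PiM) auto
  also have "\<dots> = (\<Prod>i\<in>UNIV. ennreal (gauss.prob (X i)))"
    by (simp add: gauss.emeasure_eq_measure)
  also have "\<dots> = ennreal (\<Prod>i\<in>UNIV. gauss.prob (X i))"
    by (rule prod_ennreal) simp
  finally have "measure (gauss_PiM UNIV) (Pi\<^sub>E UNIV X) = (\<Prod>i\<in>UNIV. gauss.prob (X i))"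
    by (simp add: measure_def prod_nonneg)
  also have "\<dots> > 0"
    using X by (intro prod_pos gauss_open_pos) auto
  finally have "0 < measure (gauss_PiM UNIV) (Pi\<^sub>E UNIV X)" .
  also have "\<dots> \<le> measure (gauss_PiM UNIV) A"
    using X(3) A(1) by (intro P.finite_measure_mono) (auto simp: sets)
  finally show ?thesis .
qed

lemma std_gaussian_vector_distr:
  fixes g :: "'w \<Rightarrow> real ^ 'n" and F :: "real ^ 'n \<Rightarrow> real"
  assumes "prob_space P" "std_gaussian_vector P g" and F: "continuous_on UNIV F"
  shows "(\<lambda>\<omega>. F (g \<omega>)) \<in> borel_measurable P"
    and "distr P borel (\<lambda>\<omega>. F (g \<omega>)) = distr (gauss_PiM UNIV) borel (\<lambda>x. F (\<chi> i. x i))"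
proof -
  interpret prob_space P by fact
  have indep: "indep_vars (\<lambda>_. borel) (\<lambda>i \<omega>. g \<omega> $ i) UNIV"
    and dist: "\<And>i. distributed P lborel (\<lambda>\<omega>. g \<omega> $ i) std_normal_density"
    using assms(2) by (auto simp: std_gaussian_vector_def)
  have rv: "(\<lambda>\<omega>. g \<omega> $ i) \<in> borel_measurable P" for i
    using indep by (auto simp: indep_vars_def)
  have gm: "(\<lambda>\<omega> i. g \<omega> $ i) \<in> measurable P (PiM UNIV (\<lambda>_. borel))"
    by (rule measurable_PiM_single') (use rv in \<open>auto simp: PiE_def\<close>)
  have Fc: "continuous_on UNIV (\<lambda>x. F (\<chi> i. x i))"
    by (rule continuous_on_compose2[OF F]) (auto intro!: continuous_on_vec_lambda)
  have Fm: "(\<lambda>x. F (\<chi> i. x i)) \<in> borel_measurable (PiM UNIV (\<lambda>_. borel))"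
    using borel_measurable_continuous_onI[OF Fc]
    by (subst measurable_cong_sets[OF sets_PiM_equal_borel refl])
  show "(\<lambda>\<omega>. F (g \<omega>)) \<in> borel_measurable P"
    using measurable_compose[OF gm Fm] by simp
  have "distr P borel (\<lambda>\<omega>. g \<omega> $ i) = std_gauss" for i
    using distributed_distr_eq_density[OF dist[of i]] by (simp cong: distr_cong)
  then have "distr P (PiM UNIV (\<lambda>_. borel)) (\<lambda>\<omega>. \<lambda>i\<in>UNIV. g \<omega> $ i) = gauss_PiM UNIV"
    using indep_vars_iff_distr_eq_PiM'[where I=UNIV and M'="\<lambda>_. borel" and X="\<lambda>i \<omega>. g \<omega> $ i"]
      rv indep by simp
  then have "distr (gauss_PiM UNIV) borel (\<lambda>x. F (\<chi> i. x i)) = 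
     distr (distr P (PiM UNIV (\<lambda>_. borel)) (\<lambda>\<omega> i. g \<omega> $ i)) borel (\<lambda>x. F (\<chi> i. x i))"
    by (simp add: restrict_UNIV)
  also have "\<dots> = distr P borel (\<lambda>\<omega>. F (g \<omega>))"
    by (subst distr_distr[OF Fm gm]) (simp add: o_def)
  finally show "distr P borel (\<lambda>\<omega>. F (g \<omega>)) = distr (gauss_PiM UNIV) borel (\<lambda>x. F (\<chi> i. x i))" ..
qed

lemma gauss_vector_convex_rearrangement:
  fixes F :: "real ^ 'n \<Rightarrow> real"
  assumes conv: "convex_on UNIV F"
  obtains k where "convex_on UNIV k" "mono k"
    "distr std_gauss borel k = distr (gauss_PiM UNIV) borel (\<lambda>x. F (\<chi> i. x i))"
proof -
  interpret P: prob_space "gauss_PiM (UNIV :: 'n set)" by (rule prob_space_gauss_PiM)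
  have F: "continuous_on UNIV F" using conv by (intro convex_on_continuous) auto
  have Fc: "continuous_on UNIV (\<lambda>x. F (\<chi> i. x i))"
    by (rule continuous_on_compose2[OF F]) (auto intro!: continuous_on_vec_lambda)
  show ?thesis
  proof (rule gauss_rearrangement)
    show "real_distribution (distr (gauss_PiM UNIV) borel (\<lambda>x. F (\<chi> i. x i)))"
      by (intro P.real_distribution_distr measurable_continuous_gauss_PiM Fc)
    fix l z0 z1 \<tau>0 \<tau>1 :: real
    assume l: "0 < l" "l < 1" and z: "\<Phi> z0 \<le> cdf (distr (gauss_PiM UNIV) borel (\<lambda>x. F (\<chi> i. x i))) \<tau>0"
      "\<Phi> z1 \<le> cdf (distr (gauss_PiM UNIV) borel (\<lambda>x. F (\<chi> i. x i))) \<tau>1"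
    show "\<Phi> ((1 - l) * z0 + l * z1) \<le> cdf (distr (gauss_PiM UNIV) borel (\<lambda>x. F (\<chi> i. x i))) ((1 - l) * \<tau>0 + l * \<tau>1)"
    proof (rule ehrhard_convex_cdf[OF finite Fc l _ z])
      fix x y :: "'n \<Rightarrow> real"
      have "(\<chi> i. (1 - l) * x i + l * y i) = (1 - l) *\<^sub>R (\<chi> i. x i) + l *\<^sub>R (\<chi> i. y i)"
        by (simp add: vec_eq_iff)
      then show "F (\<chi> i. (1 - l) * x i + l * y i) \<le> (1 - l) * F (\<chi> i. x i) + l * F (\<chi> i. y i)"
        using convex_onD[OF conv, of l] l by simp
    qed
  qed (rule that)
qed

text \<open>A nonconstant continuous F differs from m on a nonempty open set, which has positive
  Gaussian measure. This is what makes the variance of F(g) positive.\<close>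

lemma gauss_vector_nonconstant:
  fixes F :: "real ^ 'n \<Rightarrow> real"
  assumes F: "continuous_on UNIV F" and nc: "\<not> F constant_on UNIV"
  shows "measure (distr (gauss_PiM UNIV) borel (\<lambda>x. F (\<chi> i. x i))) {m} < 1"
proof -
  interpret P: prob_space "gauss_PiM (UNIV :: 'n set)" by (rule prob_space_gauss_PiM)
  have Fc: "continuous_on UNIV (\<lambda>x. F (\<chi> i. x i))"
    by (rule continuous_on_compose2[OF F]) (auto intro!: continuous_on_vec_lambda)
  let ?A = "{x. F (\<chi> i. x i) \<noteq> m}"
  have Fm: "(\<lambda>x. F (\<chi> i. x i)) \<in> borel_measurable (gauss_PiM UNIV)"
    by (rule measurable_continuous_gauss_PiM[OF Fc])
  obtain v where "F v \<noteq> m" using nc by (auto simp: constant_on_def)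
  then have "(\<lambda>i. v $ i) \<in> ?A" by simp
  then have "?A \<noteq> {}" by blast
  moreover have "open ?A" using Fc by (intro open_Collect_neq) auto
  ultimately have "0 < P.prob ?A" by (rule gauss_PiM_open_pos[rotated])
  moreover have "P.prob ?A = 1 - P.prob ((\<lambda>x. F (\<chi> i. x i)) -` {m} \<inter> space (gauss_PiM UNIV))"
  proof -
    have "?A = space (gauss_PiM UNIV) - ((\<lambda>x. F (\<chi> i. x i)) -` {m} \<inter> space (gauss_PiM UNIV))"
      by (auto simp: space_PiM)
    then show ?thesis
      using P.prob_compl[OF measurable_sets[OF Fm, of "{m}"]] by simp
  qed
  ultimately show ?thesis using Fm by (simp add: measure_distr)
qed

text \<open>Nonconstancy of F is assumed because for constant F the variance is 0 and both events
  are certain, so that the bounds, which are below 1, fail.\<close>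

theorem theorem3:
  fixes P :: "'w measure" and g :: "'w \<Rightarrow> real ^ 'n" and F :: "real ^ 'n \<Rightarrow> real"
    and M t :: real
  assumes "prob_space P"
    and "std_gaussian_vector P g"
    and "convex_on UNIV F"
    and "\<not> F constant_on UNIV"
    and "integrable P (\<lambda>\<omega>. \<bar>F (g \<omega>)\<bar>\<^sup>2)"
    and "is_median P (\<lambda>\<omega>. F (g \<omega>)) M"
    and "t > 0"
  shows "measure P {\<omega> \<in> space P.
             F (g \<omega>) - prob_space.expectation P (\<lambda>\<omega>. F (g \<omega>))
               \<le> - t * sqrt (prob_space.variance P (\<lambda>\<omega>. F (g \<omega>)))}
           \<le> exp (- (t\<^sup>2 / 2)) \<and>
         measure P {\<omega> \<in> space P.
             F (g \<omega>) - M \<le> - t * sqrt (prob_space.variance P (\<lambda>\<omega>. F (g \<omega>)))}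
           \<le> exp (- (t\<^sup>2 / 2))"
proof -
  interpret prob_space P by fact
  have F: "continuous_on UNIV F" using assms(3) by (intro convex_on_continuous) auto
  define Y where "Y = (\<lambda>\<omega>. F (g \<omega>))"
  have Y [measurable]: "Y \<in> borel_measurable P"
    unfolding Y_def by (rule std_gaussian_vector_distr[OF assms(1,2) F])
  note Yd = std_gaussian_vector_distr(2)[OF assms(1,2) F, folded Y_def]
  obtain k where k: "convex_on UNIV k" "mono k" "distr std_gauss borel k = distr P borel Y"
    using gauss_vector_convex_rearrangement[OF assms(3)] Yd by metis
  have [measurable]: "k \<in> borel_measurable borel" using k(2) by (rule borel_measurable_mono)
  have km: "k \<in> borel_measurable std_gauss" by simp
  have E: "expectation (\<lambda>\<omega>. h (Y \<omega>)) = gauss.expectation (\<lambda>z. h (k z))" 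
    if "h \<in> borel_measurable borel" for h :: "real \<Rightarrow> real"
    using integral_distr[OF Y that] integral_distr[OF km that] k(3) by simp
  have prob: "prob {\<omega> \<in> space P. Y \<omega> \<in> A} = gauss.prob {z. k z \<in> A}" if "A \<in> sets borel" for A
  proof -
    have "prob {\<omega> \<in> space P. Y \<omega> \<in> A} = measure (distr P borel Y) A"
      using that Y by (simp add: measure_distr vimage_def Int_def conj_commute)
    also have "\<dots> = gauss.prob {z. k z \<in> A}"
      unfolding k(3)[symmetric] using that km by (simp add: measure_distr vimage_def)
    finally show ?thesis .
  qed
  have int2: "integrable std_gauss (\<lambda>z. (k z)\<^sup>2)"
  proof -
    have "integrable P (\<lambda>\<omega>. (Y \<omega>)\<^sup>2)" using assms(5) by (simp add: Y_def)
    then have "integrable (distr P borel Y) (\<lambda>y. y\<^sup>2)" by (subst integrable_distr_eq) auto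
    then show ?thesis unfolding k(3)[symmetric] using km by (subst (asm) integrable_distr_eq) auto
  qed
  have int: "integrable std_gauss k" using int2 by (rule gauss_integrable_of_square[rotated]) measurable
  have EY: "expectation Y = gauss.expectation k" using E[of "\<lambda>y. y"] by simp
  have VY: "expectation (\<lambda>\<omega>. (Y \<omega> - gauss.expectation k)\<^sup>2) = gauss.variance k"
    using E[of "\<lambda>y. (y - gauss.expectation k)\<^sup>2"] by simp
  define m where "m = gauss.expectation k"
  \<comment> \<open>Zero variance would make k almost surely equal to m, so the common law of k and
    F(g) would be a point mass.\<close>
  have var: "0 < gauss.variance k"
  proof (rule ccontr)
    assume "\<not> 0 < gauss.variance k"
    then have "gauss.variance k = 0" using gauss.variance_positive[of k] by linarith
    moreover have "integrable std_gauss (\<lambda>z. (k z - m)\<^sup>2)"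
      using int int2 by (simp add: power2_diff)
    ultimately have "AE z in std_gauss. (k z - m)\<^sup>2 = 0"
      unfolding m_def by (subst integral_nonneg_eq_0_iff_AE[symmetric]) auto
    then have "AE z in std_gauss. k z \<in> {m}" by eventually_elim simp
    moreover have "{z. k z \<in> {m}} \<in> sets std_gauss" by simp
    ultimately have "gauss.prob {z. k z \<in> {m}} = 1"
      using gauss.AE_in_set_eq_1[of "{z. k z \<in> {m}}"] by simp
    then have "measure (distr P borel Y) {m} = 1"
      unfolding k(3)[symmetric] using km by (simp add: measure_distr vimage_def)
    then show False
      using gauss_vector_nonconstant[OF F assms(4), of m] by (simp add: Yd)
  qed
  define d where "d = t * sqrt (gauss.variance k)"
  have tail: "prob {\<omega> \<in> space P. Y \<omega> \<in> {..m - d}} \<le> exp (- (t\<^sup>2 / 2))"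
    using gauss_convex_lower_tail[OF k(1,2) int2 var assms(7)] prob[of "{..m - d}"]
    by (simp add: m_def d_def)
  have Mm: "M \<le> m"
  proof -
    have "1 / 2 \<le> prob {\<omega> \<in> space P. Y \<omega> \<in> {M..}}"
      using assms(6) by (simp add: is_median_def Y_def)
    then show ?thesis
      unfolding m_def using prob[of "{M..}"]
      by (intro gauss_convex_median_le_mean[OF k(1,2) int]) simp
  qed
  \<comment> \<open>Any centre below the mean gives a smaller event; the mean itself and the median
    M are the two instances.\<close>
  have "prob {\<omega> \<in> space P. Y \<omega> - x \<le> - d} \<le> exp (- (t\<^sup>2 / 2))" if "x \<le> m" for x
  proof -
    have "prob {\<omega> \<in> space P. Y \<omega> - x \<le> - d} \<le> prob {\<omega> \<in> space P. Y \<omega> \<in> {..m - d}}"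
      using that by (intro finite_measure_mono) auto
    then show ?thesis using tail by linarith
  qed
  from this[of m] this[of M] Mm show ?thesis
    unfolding m_def d_def using EY VY by (simp add: Y_def)
qed

end
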